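(* Let $\mathcal{C}$ be a simple arrangement of $n$ great-circles on the unit sphere $\mathbb{S}^2$ and let $k$ be a nonnegative integer with $k < n/3$. If a cell $F$ of $\mathcal{C}$ (the "south pole" cell) is chosen uniformly at random among all cells of $\mathcal{C}$, then the expected number of vertices of $\mathcal{C}$ at distance exactly $k$ from $F$ (the expected size of the $k$-level) is at most $4e\cdot(k+2)^2$.
   Context: An arrangement of great-circles on $\mathbb{S}^2$ is simple if no three of its great-circles pass through a common point. Vertices are intersection points of two great-circles of the arrangement; cells are the connected components of the complement of the union of the great-circles. For points (or sets such as vertices and cells) $x,y$ of $\mathbb{S}^2$, the distance relative to $\mathcal{C}$ is the minimum number of great-circles of $\mathcal{C}$ intersected by the interior of a curve connecting (a point of) $x$ with (a point of) $y$. The $k$-level with respect to the south pole cell $F$ is the set of vertices at distance $k$ from $F$. Here $e$ is Euler's number. *)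

theory Defs
  imports "HOL-Analysis.Analysis"
begin

definition S2 :: "(real^3) set" where
  "S2 = sphere 0 1"

definition great_circle :: "real^3 \<Rightarrow> (real^3) set" where
  "great_circle u = {x \<in> S2. u \<bullet> x = 0}"

definition is_great_circle :: "(real^3) set \<Rightarrow> bool" where
  "is_great_circle c \<longleftrightarrow> (\<exists>u. u \<noteq> 0 \<and> c = great_circle u)"

definition arrangement :: "(real^3) set set \<Rightarrow> bool" where
  "arrangement C \<longleftrightarrow> finite C \<and> (\<forall>c\<in>C. is_great_circle c)"

definition simple_arrangement :: "(real^3) set set \<Rightarrow> bool" where
  "simple_arrangement C \<longleftrightarrow> arrangement C \<and>
     (\<forall>a\<in>C. \<forall>b\<in>C. \<forall>c\<in>C. a \<noteq> b \<and> a \<noteq> c \<and> b \<noteq> c \<longrightarrow> a \<inter> b \<inter> c = {})"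

definition vertices :: "(real^3) set set \<Rightarrow> (real^3) set" where
  "vertices C = {p. \<exists>a\<in>C. \<exists>b\<in>C. a \<noteq> b \<and> p \<in> a \<inter> b}"

definition cells :: "(real^3) set set \<Rightarrow> (real^3) set set" where
  "cells C = components (S2 - \<Union>C)"

definition arr_dist :: "(real^3) set set \<Rightarrow> (real^3) set \<Rightarrow> (real^3) set \<Rightarrow> nat" where
  "arr_dist C X Y = Inf {card {c \<in> C. g ` {0<..<1} \<inter> c \<noteq> {}} | g.
      path g \<and> path_image g \<subseteq> S2 \<and> g 0 \<in> X \<and> g 1 \<in> Y}"

definition level :: "(real^3) set set \<Rightarrow> nat \<Rightarrow> (real^3) set \<Rightarrow> (real^3) set" where
  "level C k F = {v \<in> vertices C. arr_dist C {v} F = k}"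

end

theory Submission
  imports Defs
begin

text \<open>Choose normals for the great circles, so that a cell becomes the set of normals with positive
  inner product and the distance from a vertex to a cell is the number of circles strictly separating
  them. Call two vertices without a common circle visible in a subarrangement if they lie on a common
  cell of it.

  By the zone theorem, the cells F of a simple arrangement of r great circles satisfy
  sum |F| (|F| - 1) \<le> 16 r (r - 1), hence there are at most 8 r (r - 1) ordered visible pairs.
  Sampling every circle with probability p (Clarkson-Shor), a pair of vertices with j separating circles
  becomes visible with probability p^4 (1 - p)^j, so the sum of (1 - p)^j over all such pairs is at
  most 8 n (n - 1) / p^2.

  Every cell has at least three corners. Replacing a cell F at distance k from v by its corners w thus
  gives three pairs (v, w), each with at most k separating circles, and a pair (v, w) arises from at
  most two such cells. With p = 2 / (k + 2) this bounds the number of (v, F) at distance k by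
  n (n - 1) (4/3 e^2 (k + 2)^2 + 16/3), the last summand coming from pairs on a common circle. For
  k \<ge> 1 this is at most 4 e (k + 2)^2 n (n - 1), and there are at least n (n - 1) cells.\<close>

section \<open>Sign vectors of vectors in general position\<close>

text \<open>Sampling needs configurations with a fixed number of defining circles: a vertex has two,
  a cell can have many. This is why a cell is traded for its corners. Two vertices without a common
  circle have four defining circles, hence p^4; pairs sharing one circle are counted directly: two
  shared circles, two numbers of separating circles, two vertices w and two cells give a factor 16
  per vertex v. Visible pairs: each corner of F has three corners, itself included, on its two
  edges, so F carries at most |F| (|F| - 3) ordered pairs. As the |F| sum to 4 r (r - 1), this
  leaves 16 r (r - 1) - 2 * 4 r (r - 1). A multiple of r (r - 1) averages exactly under sampling, to
  p^2 n (n - 1). The value p = 2 / (k + 2) maximises p^2 (1 - p)^k, and there (1 - p)^k is at least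
  e^(-2); so 2/3 * 8 / p^2 * e^2 is the main term 4/3 e^2 (k + 2)^2. Since e < 3, there is room
  below 4 e (k + 2)^2 for the remaining 16/3. All counting concerns sign vectors; topology enters
  only when these are matched with components and curves at the end.\<close>

unbundle cross3_syntax

text \<open>Lagrange's identity makes \<open>(a \<times> b) \<times> p\<close> vanish; applied once
  more, it yields the factor.\<close>

lemma parallel_cross:
  assumes "a \<bullet> p = 0" "b \<bullet> p = 0" "a \<times> b \<noteq> 0"
  obtains m where "p = m *\<^sub>R (a \<times> b)"
proof
  let ?n = "a \<times> b"
  have "?n \<times> p = 0"
    using assms Lagrange[of p a b] cross_skew[of ?n p] by (simp add: inner_commute)
  then have "(?n \<bullet> p) *\<^sub>R ?n = (?n \<bullet> ?n) *\<^sub>R p"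
    using Lagrange[of ?n ?n p] by simp
  then have "inverse (?n \<bullet> ?n) *\<^sub>R ((?n \<bullet> p) *\<^sub>R ?n) = p"
    using assms(3) by simp
  then show "p = (inverse (?n \<bullet> ?n) * (?n \<bullet> p)) *\<^sub>R ?n"
    by simp
qed

lemma triple_swap: "c \<bullet> (a \<times> b) = - (b \<bullet> (a \<times> c))"
  by (simp add: cross3_simps)

definition general_position :: "(real^3) set \<Rightarrow> bool" where
  "general_position U \<longleftrightarrow> finite U \<and> 0 \<notin> U \<and>
     (\<forall>a\<in>U. \<forall>b\<in>U. a \<noteq> b \<longrightarrow> a \<times> b \<noteq> 0) \<and>
     (\<forall>a\<in>U. \<forall>b\<in>U. \<forall>c\<in>U. a \<noteq> b \<longrightarrow> a \<noteq> c \<longrightarrow> b \<noteq> c \<longrightarrow> c \<bullet> (a \<times> b) \<noteq> 0)"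

text \<open>At a point on no circle this set is the whole sign vector. It is also taken at vertices
  and on edges, where a zero counts as not positive.\<close>

definition positive :: "(real^3) set \<Rightarrow> real^3 \<Rightarrow> (real^3) set" where
  "positive U x = {u\<in>U. u \<bullet> x > 0}"

definition chambers :: "(real^3) set \<Rightarrow> (real^3) set set" where
  "chambers U = positive U ` {x. \<forall>u\<in>U. u \<bullet> x \<noteq> 0}"

lemma gp_finite: "general_position U \<Longrightarrow> finite U"
  and gp_zero: "general_position U \<Longrightarrow> 0 \<notin> U"
  and gp_pair: "general_position U \<Longrightarrow> a \<in> U \<Longrightarrow> b \<in> U \<Longrightarrow> a \<noteq> b \<Longrightarrow> a \<times> b \<noteq> 0"
  and gp_triple: "general_position U \<Longrightarrow> a \<in> U \<Longrightarrow> b \<in> U \<Longrightarrow> c \<in> U \<Longrightarrow>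
    a \<noteq> b \<Longrightarrow> a \<noteq> c \<Longrightarrow> b \<noteq> c \<Longrightarrow> c \<bullet> (a \<times> b) \<noteq> 0"
  and gp_subset: "general_position U \<Longrightarrow> R \<subseteq> U \<Longrightarrow> general_position R"
  unfolding general_position_def by (blast dest: finite_subset)+

lemma finite_chambers: "finite U \<Longrightarrow> finite (chambers U)"
  by (rule finite_subset[of _ "Pow U"]) (auto simp: chambers_def positive_def)

lemma chambersI: "(\<And>u. u \<in> U \<Longrightarrow> u \<bullet> x \<noteq> 0) \<Longrightarrow> A = positive U x \<Longrightarrow> A \<in> chambers U"
  by (auto simp: chambers_def)

lemma chambersE:
  assumes "A \<in> chambers U"
  obtains x where "\<And>u. u \<in> U \<Longrightarrow> u \<bullet> x \<noteq> 0" "A = positive U x"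
  using assms by (auto simp: chambers_def)

lemma chambers_subset: "A \<in> chambers U \<Longrightarrow> A \<subseteq> U"
  by (auto simp: chambers_def positive_def)

lemma perturb:
  fixes w z :: "real^3"
  assumes "finite U"
  obtains y where "\<And>u. u \<in> U \<Longrightarrow> u \<bullet> w > 0 \<Longrightarrow> u \<bullet> y > 0"
    "\<And>u. u \<in> U \<Longrightarrow> u \<bullet> w < 0 \<Longrightarrow> u \<bullet> y < 0"
    "\<And>u. u \<bullet> w = 0 \<Longrightarrow> u \<bullet> y = u \<bullet> z"
proof -
  \<comment> \<open>\<open>T\<close> exceeds every ratio of \<open>\<bar>u \<bullet> z\<bar>\<close>
    to \<open>\<bar>u \<bullet> w\<bar>\<close>; normals with \<open>u \<bullet> w = 0\<close>
    contribute 0, the value of a division by zero. Scaling \<open>w\<close> up by \<open>T\<close>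
    replaces a small step from \<open>w\<close> in direction \<open>z\<close>.\<close>
  define T where "T = 1 + (\<Sum>u\<in>U. \<bar>u \<bullet> z\<bar> / \<bar>u \<bullet> w\<bar>)"
  have T: "T * \<bar>u \<bullet> w\<bar> > \<bar>u \<bullet> z\<bar>" if "u \<in> U" "u \<bullet> w \<noteq> 0" for u
  proof -
    have "\<bar>u \<bullet> z\<bar> / \<bar>u \<bullet> w\<bar> \<le> (\<Sum>u\<in>U. \<bar>u \<bullet> z\<bar> / \<bar>u \<bullet> w\<bar>)"
      by (rule member_le_sum) (use that assms in auto)
    then have "\<bar>u \<bullet> z\<bar> / \<bar>u \<bullet> w\<bar> < T" by (simp add: T_def)
    then show ?thesis using that by (simp add: field_simps)
  qed
  show ?thesis
  proof (rule that[of "T *\<^sub>R w + z"])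
    fix u assume "u \<in> U" "u \<bullet> w > 0"
    then show "u \<bullet> (T *\<^sub>R w + z) > 0" using T[of u] by (auto simp: inner_add_right)
  next
    fix u assume "u \<in> U" "u \<bullet> w < 0"
    then show "u \<bullet> (T *\<^sub>R w + z) < 0" using T[of u] by (auto simp: inner_add_right)
  qed (simp add: inner_add_right)
qed

lemma zero_set_cases:
  assumes gp: "general_position U" and "w \<noteq> 0"
  obtains "{u\<in>U. u \<bullet> w = 0} = {}" | a where "a \<in> U" "{u\<in>U. u \<bullet> w = 0} = {a}"
  | a b where "a \<in> U" "b \<in> U" "a \<noteq> b" "{u\<in>U. u \<bullet> w = 0} = {a, b}"
proof -
  let ?Z = "{u\<in>U. u \<bullet> w = 0}"
  \<comment> \<open>A point on two circles is a multiple of the cross product of their normals, so a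
    third circle through it contradicts general position.\<close>
  have *: "?Z = {a, b}" if ab: "a \<in> ?Z" "b \<in> ?Z" "a \<noteq> b" for a b
  proof (rule ccontr)
    assume "?Z \<noteq> {a, b}"
    then obtain c where c: "c \<in> ?Z" "c \<noteq> a" "c \<noteq> b" using ab by blast
    obtain m where m: "w = m *\<^sub>R (a \<times> b)"
      using parallel_cross[of a w b] ab gp_pair[OF gp, of a b] by auto
    then have "c \<bullet> (a \<times> b) = 0" using c \<open>w \<noteq> 0\<close> by auto
    then show False using gp_triple[OF gp, of a b c] ab c by auto
  qed
  show ?thesis
  proof (cases "?Z = {}")
    case False
    then obtain a where a: "a \<in> ?Z" by blast
    show ?thesis
    proof (cases "?Z = {a}")
      case False
      then obtain b where "b \<in> ?Z" "b \<noteq> a" using a by blast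
      then show ?thesis using *[of a b] a that(3) by auto
    qed (use that(2) a in auto)
  qed (rule that(1))
qed

text \<open>At most two normals vanish at a nonzero point and these are linearly independent, so their
  signs near the point can be chosen freely.\<close>

lemma free_signs:
  assumes gp: "general_position U" and w: "w \<noteq> 0" and S: "S \<subseteq> {u\<in>U. u \<bullet> w = 0}"
  shows "positive U w \<union> S \<in> chambers U"
proof -
  have "\<exists>z. \<forall>u\<in>U. u \<bullet> w = 0 \<longrightarrow> (u \<in> S \<longrightarrow> u \<bullet> z > 0) \<and> (u \<notin> S \<longrightarrow> u \<bullet> z < 0)"
    using gp w
  proof (cases rule: zero_set_cases)
    case 1
    then show ?thesis by auto
  next
    case (2 a)
    then have "a \<bullet> a > 0" using gp_zero[OF gp] by auto
    then have "\<forall>u\<in>{a}. (u \<in> S \<longrightarrow> u \<bullet> ((if a \<in> S then 1 else -1) *\<^sub>R a) > 0) \<and>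
        (u \<notin> S \<longrightarrow> u \<bullet> ((if a \<in> S then 1 else -1) *\<^sub>R a) < 0)"
      by simp
    then show ?thesis using 2(2) by blast
  next
    case (3 a b)
    let ?n = "a \<times> b"
    \<comment> \<open>Up to the factor \<open>?n \<bullet> ?n\<close>, the vectors
      \<open>b \<times> ?n\<close> and \<open>?n \<times> a\<close> form the dual basis of
      \<open>a\<close>, \<open>b\<close>, so the two signs are prescribed independently.\<close>
    define z where "z = (if a \<in> S then 1 else -1) *\<^sub>R (b \<times> ?n) + (if b \<in> S then 1 else -1) *\<^sub>R (?n \<times> a)"
    have n: "?n \<bullet> ?n > 0" using 3 gp_pair[OF gp, of a b] by simp
    have "a \<bullet> (b \<times> ?n) = ?n \<bullet> ?n" "b \<bullet> (?n \<times> a) = ?n \<bullet> ?n"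
      using cross_triple by (metis inner_commute)+
    then have "a \<bullet> z = (if a \<in> S then 1 else -1) * (?n \<bullet> ?n)"
      "b \<bullet> z = (if b \<in> S then 1 else -1) * (?n \<bullet> ?n)"
      unfolding z_def inner_add_right inner_scaleR_right by (simp_all add: dot_cross_self)
    then have "\<forall>u\<in>{a, b}. (u \<in> S \<longrightarrow> u \<bullet> z > 0) \<and> (u \<notin> S \<longrightarrow> u \<bullet> z < 0)"
      using n by auto
    then show ?thesis using 3(4) by blast
  qed
  then obtain z where z: "\<And>u. u \<in> U \<Longrightarrow> u \<bullet> w = 0 \<Longrightarrow> (u \<in> S \<longrightarrow> u \<bullet> z > 0) \<and> (u \<notin> S \<longrightarrow> u \<bullet> z < 0)"
    by blast
  obtain y where y: "\<And>u. u \<in> U \<Longrightarrow> u \<bullet> w > 0 \<Longrightarrow> u \<bullet> y > 0"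
    "\<And>u. u \<in> U \<Longrightarrow> u \<bullet> w < 0 \<Longrightarrow> u \<bullet> y < 0"
    "\<And>u. u \<bullet> w = 0 \<Longrightarrow> u \<bullet> y = u \<bullet> z"
    using perturb[OF gp_finite[OF gp], where w=w and z=z] by blast
  have yz: "(u \<bullet> y > 0 \<longleftrightarrow> u \<in> positive U w \<union> S) \<and> u \<bullet> y \<noteq> 0" if "u \<in> U" for u
    using y(1)[OF that] y(2)[OF that] y(3)[of u] z[OF that] S that
    by (cases "u \<bullet> w" "0::real" rule: linorder_cases) (auto simp: positive_def)
  show ?thesis
    by (rule chambersI[of U y]) (use yz S in \<open>auto simp: positive_def\<close>)
qed

section \<open>Vertices as ordered pairs of normals; corners and edges as sign conditions\<close>

definition opairs :: "'a set \<Rightarrow> ('a \<times> 'a) set" where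
  "opairs U = {(a, b). a \<in> U \<and> b \<in> U \<and> a \<noteq> b}"

definition ends :: "'a \<times> 'a \<Rightarrow> 'a set" where
  "ends v = {fst v, snd v}"

text \<open>An ordered pair of normals encodes the vertex on the ray through their cross product; the
  reversed pair is the antipodal vertex.\<close>

definition vpt :: "(real^3) \<times> (real^3) \<Rightarrow> real^3" where
  "vpt v = fst v \<times> snd v"

text \<open>Closure-free form of "the vertex lies on the boundary of the cell": only the two circles
  through the vertex may tell them apart.\<close>

definition corners :: "(real^3) set \<Rightarrow> (real^3) set \<Rightarrow> ((real^3) \<times> (real^3)) set" where
  "corners U A = {v\<in>opairs U. A - ends v = positive U (vpt v)}"

definition flip :: "'a \<Rightarrow> 'a set \<Rightarrow> 'a set" where
  "flip u A = (if u \<in> A then A - {u} else insert u A)"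

text \<open>An edge is named by its circle: \<open>u\<close> bounds the cell when crossing
  \<open>u\<close> alone leads to another cell.\<close>

definition edges :: "(real^3) set \<Rightarrow> (real^3) set \<Rightarrow> (real^3) set" where
  "edges U A = {u\<in>U. flip u A \<in> chambers U}"

lemma finite_opairs: "finite U \<Longrightarrow> finite (opairs U)"
  by (rule finite_subset[of _ "Sigma U (\<lambda>_. U)"]) (auto simp: opairs_def)

lemma card_opairs: "finite U \<Longrightarrow> card (opairs U) = card U * (card U - 1)"
proof -
  assume fin: "finite U"
  have "opairs U = Sigma U (\<lambda>a. U - {a})" by (auto simp: opairs_def)
  then show ?thesis using fin by (simp add: card_SigmaI)
qed

lemma finite_corners: "finite U \<Longrightarrow> finite (corners U A)"
  by (simp add: corners_def finite_opairs)

lemma finite_edges: "finite U \<Longrightarrow> finite (edges U A)"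
  by (simp add: edges_def)

lemma ends_opairs: "v \<in> opairs U \<Longrightarrow> ends v \<subseteq> U" "v \<in> opairs U \<Longrightarrow> card (ends v) = 2"
  by (auto simp: opairs_def ends_def)

lemma ends_vpt: "u \<in> ends v \<Longrightarrow> u \<bullet> vpt v = 0"
  by (auto simp: ends_def vpt_def dot_cross_self)

lemma vpt_nonzero:
  assumes "general_position U" "v \<in> opairs U"
  shows "vpt v \<noteq> 0"
  using assms gp_pair by (auto simp: opairs_def vpt_def)

lemma vpt_zero_iff:
  assumes "general_position U" "v \<in> opairs U" "u \<in> U"
  shows "u \<bullet> vpt v = 0 \<longleftrightarrow> u \<in> ends v"
proof
  assume "u \<bullet> vpt v = 0"
  then have "u = fst v \<or> u = snd v"
    using assms(2) gp_triple[OF assms(1) _ _ assms(3), of "fst v" "snd v"]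
    by (force simp: opairs_def vpt_def)
  then show "u \<in> ends v" by (simp add: ends_def)
qed (rule ends_vpt)

text \<open>The two normals vanishing at the vertex have free signs, so all four choices around a
  vertex give cells.\<close>

lemma vertex_chambers:
  assumes gp: "general_position U" and v: "v \<in> opairs U" and A: "A \<subseteq> U" "A - ends v = positive U (vpt v)"
  shows "A \<in> chambers U"
proof -
  have "positive U (vpt v) \<union> (A \<inter> ends v) \<in> chambers U"
    by (rule free_signs[OF gp vpt_nonzero[OF gp v]]) (use ends_vpt A(1) in blast)
  moreover have "positive U (vpt v) \<union> (A \<inter> ends v) = A" using A by blast
  ultimately show ?thesis by simp
qed

lemma corner_edges:
  assumes gp: "general_position U" and v: "v \<in> corners U A" and A: "A \<subseteq> U"
  shows "ends v \<subseteq> edges U A"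
proof
  fix u assume u: "u \<in> ends v"
  have vo: "v \<in> opairs U" and e: "A - ends v = positive U (vpt v)"
    using v by (auto simp: corners_def)
  have "u \<in> U" using u ends_opairs vo by blast
  moreover have "flip u A \<in> chambers U"
    by (rule vertex_chambers[OF gp vo]) (use u e A \<open>u \<in> U\<close> in \<open>auto simp: flip_def\<close>)
  ultimately show "u \<in> edges U A" by (simp add: edges_def)
qed

text \<open>The point is a multiple of \<open>a \<times> b\<close>; the sign of the factor selects
  which of the antipodal vertices \<open>(a, b)\<close> and \<open>(b, a)\<close> it
  represents.\<close>

lemma corner_of_point:
  assumes gp: "general_position U" and ab: "a \<in> U" "b \<in> U" "a \<noteq> b"
    and w: "w \<noteq> 0" "a \<bullet> w = 0" "b \<bullet> w = 0" and A: "A - {a, b} = positive U w"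
  obtains v m where "v \<in> corners U A" "ends v = {a, b}" "m > 0" "w = m *\<^sub>R vpt v"
proof -
  obtain m where m: "w = m *\<^sub>R (a \<times> b)"
    using parallel_cross w(2,3) gp_pair[OF gp ab] by blast
  then have "m \<noteq> 0" using w by auto
  then consider "m > 0" | "m < 0" by linarith
  then show ?thesis
  proof cases
    case 1
    show ?thesis
    proof (rule that[of "(a,b)" m])
      have "positive U w = positive U (a \<times> b)"
        using 1 m by (simp add: positive_def zero_less_mult_iff)
      then show "(a, b) \<in> corners U A"
        using ab A by (simp add: corners_def opairs_def ends_def vpt_def)
    qed (use 1 m in \<open>auto simp: ends_def vpt_def\<close>)
  next
    case 2
    have w': "w = (-m) *\<^sub>R (b \<times> a)" using m cross_skew[of a b] by simp
    show ?thesis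
    proof (rule that[of "(b,a)" "-m"])
      have "positive U w = positive U (b \<times> a)"
        using 2 w' by (simp add: positive_def mult_less_0_iff)
      then show "(b, a) \<in> corners U A"
        using ab A by (simp add: corners_def opairs_def ends_def vpt_def insert_commute)
    qed (use 2 w' in \<open>auto simp: ends_def vpt_def\<close>)
  qed
qed

section \<open>Edges and corners of a chamber\<close>

text \<open>For large \<open>t\<close> all signs are those of \<open>y\<close>. The largest zero of
  the functionals is the first circle met as \<open>t\<close> decreases, so at that moment signs
  have at most become zero.\<close>

lemma first_hit:
  fixes y d :: "'a::real_inner"
  assumes "finite V" "V \<noteq> {}" "\<And>u. u \<in> V \<Longrightarrow> u \<bullet> y \<noteq> 0"
  obtains t u where "u \<in> V" "u \<bullet> (t *\<^sub>R y + d) = 0"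
    "\<And>u. u \<in> V \<Longrightarrow> (u \<bullet> (t *\<^sub>R y + d)) * (u \<bullet> y) \<ge> 0"
proof -
  define f where "f u = - (u \<bullet> d) / (u \<bullet> y)" for u
  have eq: "u \<bullet> (t *\<^sub>R y + d) = (u \<bullet> y) * (t - f u)" if "u \<in> V" for u t
    using assms(3)[OF that] by (simp add: f_def inner_add_right field_simps)
  have "Max (f ` V) \<in> f ` V" using assms by (intro Max_in) auto
  then obtain u where u: "u \<in> V" "f u = Max (f ` V)" by auto
  show ?thesis
  proof (rule that[of u "Max (f ` V)"])
    show "u \<bullet> (Max (f ` V) *\<^sub>R y + d) = 0" using eq[OF u(1)] u(2) by simp
  next
    fix v assume v: "v \<in> V"
    have "f v \<le> Max (f ` V)" using v assms by simp
    then have "(v \<bullet> y)\<^sup>2 * (Max (f ` V) - f v) \<ge> 0" by simp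
    then show "(v \<bullet> (Max (f ` V) *\<^sub>R y + d)) * (v \<bullet> y) \<ge> 0"
      using eq[OF v] by (simp add: power2_eq_square mult_ac)
  qed (fact u(1))
qed

text \<open>Walking from a point of the cell in an orthogonal direction, the first circle met bounds
  the cell: if two circles are met at once, their signs are still free and one of them can be
  flipped alone. Orthogonality keeps the walk away from 0.\<close>

lemma edges_nonempty:
  assumes gp: "general_position U" and A: "A \<in> chambers U" and ne: "U \<noteq> {}"
  shows "edges U A \<noteq> {}"
proof -
  obtain x where x: "\<And>u. u \<in> U \<Longrightarrow> u \<bullet> x \<noteq> 0" "A = positive U x"
    using A chambersE by blast
  have "x \<noteq> 0" using x ne by force
  then obtain e where "x \<times> e \<noteq> 0" using cross_basis_nonzero by blast
  then obtain d where d: "d \<noteq> 0" "x \<bullet> d = 0" using dot_cross_self(1) by blast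
  have "\<exists>t a. a \<in> U \<and> a \<bullet> (t *\<^sub>R x + d) = 0 \<and> (\<forall>u\<in>U. (u \<bullet> (t *\<^sub>R x + d)) * (u \<bullet> x) \<ge> 0)"
    by (rule first_hit[where y = x and d = d, OF gp_finite[OF gp] ne x(1)]) auto
  then obtain t a where a: "a \<in> U" "a \<bullet> (t *\<^sub>R x + d) = 0"
    and t: "\<And>u. u \<in> U \<Longrightarrow> (u \<bullet> (t *\<^sub>R x + d)) * (u \<bullet> x) \<ge> 0"
    by blast
  define w where "w = t *\<^sub>R x + d"
  have "w \<bullet> d = d \<bullet> d" using d by (simp add: w_def inner_add_left)
  then have w0: "w \<noteq> 0" using d by (metis inner_eq_zero_iff inner_zero_left)
  define Z where "Z = {u\<in>U. u \<bullet> w = 0}"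
  have *: "u \<in> A \<longleftrightarrow> u \<in> positive U w" if "u \<in> U" "u \<notin> Z" for u
    using t[OF that(1)] x(1)[OF that(1)] x(2) that
    by (auto simp: Z_def positive_def w_def[symmetric] zero_le_mult_iff)
  have "positive U w \<inter> Z = {}" "positive U w \<subseteq> U" by (auto simp: positive_def Z_def)
  then have AZ: "A - Z = positive U w" using * chambers_subset[OF A] by blast
  have "a \<in> Z" using a by (simp add: Z_def w_def)
  then have "flip a A = positive U w \<union> flip a (A \<inter> Z)"
    using AZ by (auto simp: flip_def)
  moreover have "flip a (A \<inter> Z) \<subseteq> Z" using \<open>a \<in> Z\<close> by (auto simp: flip_def)
  ultimately have "flip a A \<in> chambers U"
    using free_signs[OF gp w0] by (simp add: Z_def)
  then show ?thesis using a(1) by (auto simp: edges_def)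
qed

lemma edge_point:
  assumes A: "A \<in> chambers U" and a: "a \<in> edges U A"
  obtains y where "a \<bullet> y = 0" "positive U y = A - {a}" "\<And>u. u \<in> U \<Longrightarrow> u \<noteq> a \<Longrightarrow> u \<bullet> y \<noteq> 0"
proof -
  obtain x where x: "\<And>u. u \<in> U \<Longrightarrow> u \<bullet> x \<noteq> 0" "A = positive U x"
    using A chambersE by blast
  have aU: "a \<in> U" and "flip a A \<in> chambers U" using a by (auto simp: edges_def)
  then obtain x' where x': "\<And>u. u \<in> U \<Longrightarrow> u \<bullet> x' \<noteq> 0" "flip a A = positive U x'"
    using chambersE by blast
  \<comment> \<open>The weights make the contributions of \<open>x\<close> and \<open>x'\<close> to
    \<open>a\<close> cancel, as the cell and its neighbour differ in sign at \<open>a\<close>. Every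
    other normal has the same sign at both points, hence also at \<open>y\<close>.\<close>
  define y where "y = \<bar>a \<bullet> x'\<bar> *\<^sub>R x + \<bar>a \<bullet> x\<bar> *\<^sub>R x'"
  have pos: "\<bar>a \<bullet> x'\<bar> > 0" "\<bar>a \<bullet> x\<bar> > 0" using x x' aU by auto
  have "a \<bullet> x > 0 \<longleftrightarrow> \<not> a \<bullet> x' > 0"
    using x(2) x'(2) aU by (auto simp: flip_def positive_def split: if_splits)
  then have a0: "a \<bullet> y = 0" by (auto simp: y_def inner_add_right abs_if)
  have same: "u \<bullet> x > 0 \<longleftrightarrow> u \<bullet> x' > 0" if "u \<in> U" "u \<noteq> a" for u
  proof -
    have "u \<in> A \<longleftrightarrow> u \<in> flip a A" using that by (auto simp: flip_def)
    then show ?thesis using that x x' by (simp add: positive_def)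
  qed
  have y: "u \<bullet> y \<noteq> 0 \<and> (u \<bullet> y > 0 \<longleftrightarrow> u \<bullet> x > 0)" if u: "u \<in> U" "u \<noteq> a" for u
  proof (cases "u \<bullet> x > 0")
    case True
    then have "\<bar>a \<bullet> x'\<bar> * (u \<bullet> x) > 0" "\<bar>a \<bullet> x\<bar> * (u \<bullet> x') > 0"
      using same[OF u] pos by auto
    then show ?thesis using True by (simp add: y_def inner_add_right)
  next
    case False
    then have "u \<bullet> x < 0" "u \<bullet> x' < 0" using same[OF u] x(1)[OF u(1)] x'(1)[OF u(1)] by auto
    then have "\<bar>a \<bullet> x'\<bar> * (u \<bullet> x) < 0" "\<bar>a \<bullet> x\<bar> * (u \<bullet> x') < 0"
      using pos by (auto simp: mult_pos_neg)
    then show ?thesis using False by (simp add: y_def inner_add_right)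
  qed
  have "\<not> a \<bullet> y > 0" using a0 by simp
  then have "positive U y = A - {a}" using y x(2) unfolding positive_def by blast
  then show ?thesis using that a0 y by blast
qed

text \<open>The end of an edge is found by walking from its inner point \<open>y\<close> along the
  circle \<open>a\<close> until another circle is hit. The component along \<open>d\<close> stays
  fixed, which later tells the two ends apart.\<close>

lemma edge_corner:
  assumes gp: "general_position U" and A: "A \<in> chambers U" and a: "a \<in> edges U A"
    and two: "card U \<ge> 2"
    and y: "a \<bullet> y = 0" "positive U y = A - {a}" "\<And>u. u \<in> U \<Longrightarrow> u \<noteq> a \<Longrightarrow> u \<bullet> y \<noteq> 0"
    and d: "a \<bullet> d = 0" "y \<bullet> d = 0" "d \<noteq> 0"
  obtains v m t where "v \<in> corners U A" "a \<in> ends v" "m > 0" "t *\<^sub>R y + d = m *\<^sub>R vpt v"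
proof -
  have aU: "a \<in> U" using a by (auto simp: edges_def)
  have fin: "finite U" using gp gp_finite by blast
  have ne: "U - {a} \<noteq> {}" 
  proof
    assume "U - {a} = {}"
    then have "card U \<le> card {a}" by (intro card_mono) auto
    then show False using two by simp
  qed
  obtain t b where b: "b \<in> U - {a}" "b \<bullet> (t *\<^sub>R y + d) = 0"
    and t: "\<And>u. u \<in> U - {a} \<Longrightarrow> (u \<bullet> (t *\<^sub>R y + d)) * (u \<bullet> y) \<ge> 0"
    by (rule first_hit[OF _ ne, of y d]) (use fin y(3) in auto)
  let ?w = "t *\<^sub>R y + d"
  have "?w \<bullet> d = d \<bullet> d" using d by (simp add: inner_add_left)
  then have w0: "?w \<noteq> 0" using d by (metis inner_eq_zero_iff inner_zero_left)
  have aw: "a \<bullet> ?w = 0" using y d by (simp add: inner_add_right)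
  have nz: "u \<bullet> ?w \<noteq> 0" if u: "u \<in> U" "u \<noteq> a" "u \<noteq> b" for u
  proof
    assume "u \<bullet> ?w = 0"
    moreover obtain m where m: "?w = m *\<^sub>R (a \<times> b)"
      using parallel_cross[OF aw b(2)] gp_pair[OF gp aU, of b] b by auto
    ultimately have "u \<bullet> (a \<times> b) = 0" using w0 by auto
    then show False using gp_triple[OF gp aU, of b u] b u by auto
  qed
  have "u \<bullet> ?w > 0 \<longleftrightarrow> u \<in> A" if u: "u \<in> U" "u \<noteq> a" "u \<noteq> b" for u
  proof -
    have "u \<in> A \<longleftrightarrow> u \<bullet> y > 0" using y(2) u by (auto simp: positive_def)
    then show ?thesis using t[of u] nz[OF u] y(3)[OF u(1,2)] u
      by (auto simp: zero_le_mult_iff)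
  qed
  moreover have "\<not> a \<bullet> ?w > 0" "\<not> b \<bullet> ?w > 0" using aw b(2) by simp_all
  ultimately have "A - {a, b} = positive U ?w"
    using chambers_subset[OF A] unfolding positive_def by blast
  then obtain v m where "v \<in> corners U A" "ends v = {a, b}" "m > 0" "?w = m *\<^sub>R vpt v"
    using corner_of_point[OF gp aU _ _ w0 aw b(2)] b(1) by blast
  then show ?thesis using that by blast
qed

lemma edge_two_corners:
  assumes gp: "general_position U" and A: "A \<in> chambers U" and a: "a \<in> edges U A"
    and two: "card U \<ge> 2"
  obtains v w where "v \<in> corners U A" "w \<in> corners U A" "v \<noteq> w" "a \<in> ends v" "a \<in> ends w"
proof -
  have aU: "a \<in> U" using a by (auto simp: edges_def)
  obtain y where y: "a \<bullet> y = 0" "positive U y = A - {a}" "\<And>u. u \<in> U \<Longrightarrow> u \<noteq> a \<Longrightarrow> u \<bullet> y \<noteq> 0"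
    using edge_point[OF A a] by blast
  \<comment> \<open>The two tangent directions of the circle at \<open>y\<close> are
    \<open>?d\<close> and \<open>- ?d\<close>; the resulting corners have products of opposite sign
    with \<open>?d\<close> and are therefore distinct.\<close>
  let ?d = "a \<times> y"
  have "\<exists>u\<in>U. u \<noteq> a"
  proof (rule ccontr)
    assume "\<not> ?thesis"
    then have "card U \<le> card {a}" by (intro card_mono) auto
    then show False using two by simp
  qed
  then have "y \<noteq> 0" using y(3) by force
  moreover have "a \<noteq> 0" using aU gp_zero[OF gp] by auto
  ultimately have d0: "?d \<noteq> 0" using norm_cross_dot[of a y] y(1) by auto
  have d: "a \<bullet> ?d = 0" "y \<bullet> ?d = 0" by (simp_all add: dot_cross_self)
  obtain v m t where v: "v \<in> corners U A" "a \<in> ends v" "m > 0" "t *\<^sub>R y + ?d = m *\<^sub>R vpt v"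
    by (rule edge_corner[OF gp A a two y d d0])
  have d': "a \<bullet> (- ?d) = 0" "y \<bullet> (- ?d) = 0" "- ?d \<noteq> 0" using d d0 by simp_all
  obtain w m' t' where w: "w \<in> corners U A" "a \<in> ends w" "m' > 0" "t' *\<^sub>R y + (- ?d) = m' *\<^sub>R vpt w"
    by (rule edge_corner[OF gp A a two y d'])
  have "v \<noteq> w"
  proof
    assume "v = w"
    have "?d \<bullet> (t *\<^sub>R y + ?d) = ?d \<bullet> ?d" "?d \<bullet> (t' *\<^sub>R y + (- ?d)) = - (?d \<bullet> ?d)"
      using d by (simp_all add: inner_add_right inner_diff_right inner_commute)
    then have "m * (?d \<bullet> vpt v) > 0" "m' * (?d \<bullet> vpt v) < 0"
      using v(4) w(4) d0 \<open>v = w\<close> by simp_all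
    then show False using v(3) w(3) by (simp add: zero_less_mult_iff mult_less_0_iff)
  qed
  then show ?thesis using that v w by blast
qed

lemma corner_mem:
  assumes "v \<in> corners U A" "u \<in> U" "u \<notin> ends v"
  shows "u \<in> A \<longleftrightarrow> u \<bullet> vpt v > 0"
  using assms by (auto simp: corners_def positive_def)

text \<open>Orient the two ends of an edge by whether the other normal at a corner, in the order
  recorded by the vertex, lies in the chamber: two corners with equal orientation would
  contradict antisymmetry of the triple product.\<close>

lemma edge_at_most_two_corners:
  assumes gp: "general_position U"
  shows "card {v\<in>corners U A. a \<in> ends v} \<le> 2"
proof -
  define f where "f v = (if fst v = a then snd v \<in> A else fst v \<notin> A)" for v :: "(real^3) \<times> (real^3)"
  have vpt: "\<exists>b. b \<in> U \<and> b \<noteq> a \<and> a \<in> U \<and> (v = (a, b) \<and> f v = (b \<in> A) \<or> v = (b, a) \<and> f v = (b \<notin> A))"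
    if "v \<in> corners U A" "a \<in> ends v" for v
    using that by (auto simp: corners_def opairs_def ends_def f_def)
  have "inj_on f {v\<in>corners U A. a \<in> ends v}"
  proof (rule inj_onI, clarify)
    fix v1 v2 v1' v2'
    assume v: "(v1, v2) \<in> corners U A" "a \<in> ends (v1, v2)"
      and w: "(v1', v2') \<in> corners U A" "a \<in> ends (v1', v2')"
      and eq: "f (v1, v2) = f (v1', v2')"
    obtain b where b: "b \<in> U" "b \<noteq> a" "a \<in> U"
      "(v1, v2) = (a, b) \<and> f (v1, v2) = (b \<in> A) \<or> (v1, v2) = (b, a) \<and> f (v1, v2) = (b \<notin> A)"
      using vpt[OF v] by blast
    obtain c where c: "c \<in> U" "c \<noteq> a"
      "(v1', v2') = (a, c) \<and> f (v1', v2') = (c \<in> A) \<or> (v1', v2') = (c, a) \<and> f (v1', v2') = (c \<notin> A)"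
      using vpt[OF w] by blast
    have "b = c"
    proof (rule ccontr)
      assume "b \<noteq> c"
      have "c \<notin> ends (v1, v2)" "b \<notin> ends (v1', v2')"
        using b c \<open>b \<noteq> c\<close> by (auto simp: ends_def)
      then have 1: "c \<in> A \<longleftrightarrow> c \<bullet> vpt (v1, v2) > 0" "b \<in> A \<longleftrightarrow> b \<bullet> vpt (v1', v2') > 0"
        using corner_mem[OF v(1)] corner_mem[OF w(1)] b c by auto
      have 2: "c \<bullet> (a \<times> b) \<noteq> 0" "c \<bullet> (a \<times> b) = - (b \<bullet> (a \<times> c))"
        using gp_triple[OF gp b(3,1) c(1)] b c \<open>b \<noteq> c\<close> triple_swap[of c a b] by auto
      have 3: "b \<times> a = - (a \<times> b)" "c \<times> a = - (a \<times> c)" by (rule cross_skew)+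
      show False
        using b(4)
      proof
        assume "(v1, v2) = (a, b) \<and> f (v1, v2) = (b \<in> A)"
        then show False using c(3) eq 1 2 by (auto simp: vpt_def 3)
      next
        assume "(v1, v2) = (b, a) \<and> f (v1, v2) = (b \<notin> A)"
        then show False using c(3) eq 1 2 by (auto simp: vpt_def 3)
      qed
    qed
    then show "v1 = v1' \<and> v2 = v2'" using b(4) c(3) eq by auto
  qed
  then have "card {v\<in>corners U A. a \<in> ends v} \<le> card (UNIV :: bool set)"
    by (intro card_inj_on_le) auto
  then show ?thesis by simp
qed

lemma edge_card_corners:
  assumes gp: "general_position U" and A: "A \<in> chambers U" and a: "a \<in> edges U A"
    and two: "card U \<ge> 2"
  shows "card {v\<in>corners U A. a \<in> ends v} = 2"
proof -
  obtain v w where vw: "v \<in> corners U A" "w \<in> corners U A" "v \<noteq> w" "a \<in> ends v" "a \<in> ends w"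
    using edge_two_corners[OF assms] by blast
  then have "card {v, w} \<le> card {v\<in>corners U A. a \<in> ends v}"
    using finite_corners[OF gp_finite[OF gp]] by (intro card_mono) auto
  then show ?thesis using edge_at_most_two_corners[OF gp, of A a] vw(3) by simp
qed

text \<open>The only other vertex with these ends is the antipode. Two circles alone bound a lune
  with antipodal corners; any third circle separates them.\<close>

lemma corners_eq:
  assumes gp: "general_position U" and three: "card U \<ge> 3"
    and v: "v \<in> corners U A" and w: "w \<in> corners U A" and eq: "ends v = ends w"
  shows "v = w"
proof (rule ccontr)
  assume ne: "v \<noteq> w"
  have vo: "v \<in> opairs U" "w \<in> opairs U" using v w by (auto simp: corners_def)
  then have "w = (snd v, fst v)" using eq ne
    by (cases v; cases w) (auto simp: ends_def opairs_def doubleton_eq_iff)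
  then have vw: "vpt w = - vpt v" using cross_skew[of "snd v" "fst v"] by (simp add: vpt_def)
  have "\<exists>u\<in>U. u \<notin> ends v"
  proof (rule ccontr)
    assume "\<not> ?thesis"
    then have "card U \<le> card (ends v)" by (intro card_mono) (auto simp: ends_def)
    then show False using three ends_opairs(2)[OF vo(1)] by simp
  qed
  then obtain u where u: "u \<in> U" "u \<notin> ends v" by blast
  then have "u \<bullet> vpt v \<noteq> 0" using vpt_zero_iff[OF gp vo(1)] by simp
  then show False
    using corner_mem[OF v u] corner_mem[OF w u(1)] u(2) eq vw
    by (cases "u \<bullet> vpt v" "0::real" rule: linorder_cases) auto
qed

text \<open>Double counting of incidences: every edge has two corners and every corner lies on two
  edges.\<close>

lemma card_corners_edges:
  assumes gp: "general_position U" and A: "A \<in> chambers U" and two: "card U \<ge> 2"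
  shows "card (corners U A) = card (edges U A)"
proof -
  have fin: "finite U" using gp gp_finite by blast
  have "(\<Sum>v\<in>corners U A. card {a\<in>edges U A. a \<in> ends v}) = 2 * card (edges U A)"
    by (rule sum_multicount)
      (use finite_corners[OF fin] finite_edges[OF fin] edge_card_corners[OF gp A _ two] in auto)
  moreover have "card {a\<in>edges U A. a \<in> ends v} = 2" if v: "v \<in> corners U A" for v
  proof -
    have "{a\<in>edges U A. a \<in> ends v} = ends v"
      using corner_edges[OF gp v chambers_subset[OF A]] by blast
    moreover have "v \<in> opairs U" using v by (simp add: corners_def)
    ultimately show ?thesis using ends_opairs(2) by metis
  qed
  ultimately show ?thesis by simp
qed

lemma corner_other_end:
  assumes v: "v \<in> corners U A" and a: "a \<in> ends v"
  obtains b where "ends v = {a, b}" "b \<noteq> a"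
  using v a by (cases v) (auto simp: corners_def opairs_def ends_def)

text \<open>Besides a given edge, each of its two corners supplies one further edge, and these
  differ because distinct corners have distinct ends.\<close>

lemma three_edges:
  assumes gp: "general_position U" and A: "A \<in> chambers U" and three: "card U \<ge> 3"
  shows "card (edges U A) \<ge> 3"
proof -
  have two: "card U \<ge> 2" and ne: "U \<noteq> {}" using three by auto
  obtain a where a: "a \<in> edges U A" using edges_nonempty[OF gp A ne] by blast
  obtain v w where vw: "v \<in> corners U A" "w \<in> corners U A" "v \<noteq> w" "a \<in> ends v" "a \<in> ends w"
    using edge_two_corners[OF gp A a two] by blast
  obtain b where b: "ends v = {a, b}" "b \<noteq> a" using corner_other_end[OF vw(1,4)] by blast
  obtain c where c: "ends w = {a, c}" "c \<noteq> a" using corner_other_end[OF vw(2,5)] by blast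
  have "b \<noteq> c" using corners_eq[OF gp three vw(1,2)] vw(3) b c by auto
  have "{a, b, c} \<subseteq> edges U A"
    using corner_edges[OF gp vw(1) chambers_subset[OF A]]
      corner_edges[OF gp vw(2) chambers_subset[OF A]] b c by auto
  then have "card {a, b, c} \<le> card (edges U A)"
    using finite_edges[OF gp_finite[OF gp]] by (intro card_mono) auto
  then show ?thesis using b c \<open>b \<noteq> c\<close> by simp
qed

section \<open>The zone theorem\<close>

text \<open>Signs are taken relative to a base point \<open>q\<close> of the circle
  \<open>c\<close>, so that these sets grow along a half circle from \<open>-q\<close> to
  \<open>q\<close> and become prefixes of the order of crossings.\<close>

definition same_side :: "real^3 \<Rightarrow> (real^3) set \<Rightarrow> real^3 \<Rightarrow> (real^3) set" where
  "same_side q R x = {u\<in>R. (u \<bullet> x) * (u \<bullet> q) > 0}"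

definition half_chambers :: "real^3 \<Rightarrow> real^3 \<Rightarrow> (real^3) set \<Rightarrow> (real^3) set set" where
  "half_chambers q c R = {same_side q R x |x. (\<forall>u\<in>R. u \<bullet> x \<noteq> 0) \<and> c \<bullet> x > 0}"

definition prefixes :: "('a \<Rightarrow> real) \<Rightarrow> 'a set \<Rightarrow> 'a set set" where
  "prefixes f R = {{u\<in>R. f u < t} |t. \<forall>u\<in>R. f u \<noteq> t}"

text \<open>\<open>Q\<close> stands for an edge on \<open>c\<close> and for the cell above it on the
  side \<open>c \<bullet> x > 0\<close>. Membership of \<open>l\<close> in \<open>Q\<close> says
  that \<open>l\<close> crosses the half circle before this edge, that is, \<open>l\<close> bounds
  the cell from the left.\<close>

definition left_pairs :: "real^3 \<Rightarrow> real^3 \<Rightarrow> (real^3 \<Rightarrow> real) \<Rightarrow> (real^3) set \<Rightarrow> ((real^3) set \<times> (real^3)) set" where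
  "left_pairs q c f R = {(Q, l). Q \<in> prefixes f R \<and> l \<in> Q \<and> Q - {l} \<in> half_chambers q c R}"

text \<open>The points \<open>t *\<^sub>R q + d\<close> of a half circle cross the plane orthogonal to u at
  \<open>t = hit q d u\<close>; the edges on this half circle are the prefixes of \<open>hit q d\<close>.\<close>

definition hit :: "real^3 \<Rightarrow> real^3 \<Rightarrow> real^3 \<Rightarrow> real" where
  "hit q d u = - (u \<bullet> d) / (u \<bullet> q)"

lemma hit_minus: "hit q (-d) u = - hit q d u"
  by (simp add: hit_def)

lemma hit_eq: "u \<bullet> q \<noteq> 0 \<Longrightarrow> (u \<bullet> (t *\<^sub>R q + d)) * (u \<bullet> q) = (u \<bullet> q)\<^sup>2 * (t - hit q d u)"
  by (simp add: hit_def inner_add_right field_simps power2_eq_square)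

lemma half_chambers_restrict:
  assumes "Q \<in> half_chambers q c R" "S \<subseteq> R"
  shows "Q \<inter> S \<in> half_chambers q c S"
proof -
  obtain x where x: "\<And>u. u \<in> R \<Longrightarrow> u \<bullet> x \<noteq> 0" "c \<bullet> x > 0" "Q = same_side q R x"
    using assms by (auto simp: half_chambers_def)
  then have "Q \<inter> S = same_side q S x" using assms by (auto simp: same_side_def)
  then show ?thesis using x assms(2) by (auto simp: half_chambers_def)
qed

lemma half_chambers_antipode:
  assumes "Q \<in> half_chambers q c R" "\<And>u. u \<in> R \<Longrightarrow> u \<bullet> q \<noteq> 0"
  shows "R - Q \<in> half_chambers q (-c) R"
proof -
  obtain x where x: "\<And>u. u \<in> R \<Longrightarrow> u \<bullet> x \<noteq> 0" "c \<bullet> x > 0" "Q = same_side q R x"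
    using assms by (auto simp: half_chambers_def)
  have "(u \<bullet> x) * (u \<bullet> q) \<noteq> 0" if "u \<in> R" for u using that x assms(2) by simp
  then have "R - Q = same_side q R (-x)"
    using x(3) by (force simp: same_side_def)
  then show ?thesis using x unfolding half_chambers_def
    by (intro CollectI exI[of _ "-x"]) simp
qed

lemma prefixes_insert:
  assumes "Q \<in> prefixes f (insert m S)" "\<And>u. u \<in> S \<Longrightarrow> f u \<le> f m"
  shows "Q = insert m S \<or> m \<notin> Q \<and> Q \<in> prefixes f S"
proof -
  obtain t where t: "Q = {u\<in>insert m S. f u < t}" "\<forall>u\<in>insert m S. f u \<noteq> t"
    using assms(1) by (auto simp: prefixes_def)
  show ?thesis
  proof (cases "f m < t")
    case True
    then have "Q = insert m S" using t assms(2) by fastforce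
    then show ?thesis ..
  next
    case False
    then have "Q = {u\<in>S. f u < t}" using t by auto
    then have "Q \<in> prefixes f S" using t(2) unfolding prefixes_def by blast
    then show ?thesis using False t(1) by auto
  qed
qed

lemma prefixes_subset: "Q \<in> prefixes f R \<Longrightarrow> Q \<subseteq> R"
  by (auto simp: prefixes_def)

lemma prefixes_complement:
  assumes "Q \<in> prefixes f R"
  shows "R - Q \<in> prefixes (\<lambda>u. - f u) R"
proof -
  obtain t where t: "Q = {u\<in>R. f u < t}" "\<forall>u\<in>R. f u \<noteq> t"
    using assms by (auto simp: prefixes_def)
  then have "R - Q = {u\<in>R. - f u < - t}" by (auto simp: less_eq_real_def)
  moreover have "\<forall>u\<in>R. - f u \<noteq> - t" using t(2) by simp
  ultimately show ?thesis unfolding prefixes_def by blast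
qed

lemma finite_left_pairs: "finite R \<Longrightarrow> finite (left_pairs q c f R)"
  by (rule finite_subset[of _ "Sigma (Pow R) (\<lambda>_. R)"])
    (auto simp: left_pairs_def dest: prefixes_subset)

text \<open>Four vectors of 3-space are linearly dependent, with triple products as coefficients:
  expand \<open>(k \<times> l) \<times> (c \<times> m)\<close> in two ways. On the plane orthogonal
  to \<open>m\<close> the term of \<open>m\<close> drops out.\<close>

lemma dependence:
  fixes m :: "real^3"
  assumes "m \<bullet> p = 0"
  shows "(m \<bullet> (k \<times> l)) * (c \<bullet> p) + (m \<bullet> (l \<times> c)) * (k \<bullet> p) + (m \<bullet> (c \<times> k)) * (l \<bullet> p) = 0"
proof -
  have "(k \<times> l) \<times> (c \<times> m) = - ((c \<times> m) \<times> (k \<times> l))" by (rule cross_skew)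
  then have "(k \<bullet> (l \<times> m)) *\<^sub>R c - (k \<bullet> (l \<times> c)) *\<^sub>R m
      = - ((c \<bullet> (m \<times> l)) *\<^sub>R k - (c \<bullet> (m \<times> k)) *\<^sub>R l)"
    by (simp only: cross_cross_det dot_cross_det)
  then have "((k \<bullet> (l \<times> m)) *\<^sub>R c - (k \<bullet> (l \<times> c)) *\<^sub>R m) \<bullet> p
      = - ((c \<bullet> (m \<times> l)) *\<^sub>R k - (c \<bullet> (m \<times> k)) *\<^sub>R l) \<bullet> p"
    by simp
  moreover have "k \<bullet> (l \<times> m) = m \<bullet> (k \<times> l)" "c \<bullet> (m \<times> l) = m \<bullet> (l \<times> c)"
    "c \<bullet> (m \<times> k) = - (m \<bullet> (c \<times> k))"
    by (simp_all add: cross3_simps)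
  ultimately show ?thesis using assms by (simp add: inner_diff_left algebra_simps)
qed

text \<open>A, B, C are the coefficients of a linear dependence between three functionals on a plane, which
  take the values 0, k0, l0, then c1, k1, l1 and c2, k2, l2 at three points.\<close>

lemma sign_patterns_impossible:
  fixes A B C :: real
  assumes "B \<noteq> 0" "C \<noteq> 0"
    and w: "B * k0 + C * l0 = 0" "k0 > 0" "l0 > 0"
    and y: "A * c1 + B * k1 + C * l1 = 0" "c1 > 0" "k1 < 0" "l1 > 0"
    and z: "A * c2 + B * k2 + C * l2 = 0" "c2 > 0" "k2 > 0" "l2 < 0"
  shows False
proof (cases "B > 0")
  case True
  then have "B * k0 > 0" using w by simp
  then have "C * l0 < 0" using w by linarith
  then have C: "C < 0" using w by (simp add: mult_less_0_iff)
  have "B * k1 < 0" "C * l1 < 0" using True C y by (simp_all add: mult_pos_neg mult_neg_pos)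
  then have "A * c1 > 0" using y(1) by linarith
  then have "A > 0" using y by (simp add: zero_less_mult_iff)
  then have "A * c2 > 0" "B * k2 > 0" "C * l2 > 0" using True C z by (simp_all add: mult_neg_neg)
  then show False using z(1) by linarith
next
  case False
  then have B: "B < 0" using assms(1) by simp
  then have "B * k0 < 0" using w by (simp add: mult_neg_pos)
  then have "C * l0 > 0" using w by linarith
  then have C: "C > 0" using w by (simp add: zero_less_mult_iff)
  have "B * k1 > 0" "C * l1 > 0" using B C y by (simp_all add: mult_neg_neg)
  then have "A * c1 < 0" using y(1) by linarith
  then have "A < 0" using y by (simp add: mult_less_0_iff)
  then have "A * c2 < 0" "B * k2 < 0" "C * l2 < 0"
    using B C z by (simp_all add: mult_neg_pos mult_pos_neg)
  then show False using z(1) by linarith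
qed

text \<open>A weighted sum of points of the two cells is placed on the circle \<open>m\<close> that
  separates them. Signs on which the cells agree, including that of \<open>c\<close>,
  survive.\<close>

lemma half_chambers_cross_point:
  assumes "Q \<in> half_chambers q c R" "Q' \<in> half_chambers q c R" "m \<in> Q" "m \<notin> Q'" "m \<in> R"
    "m \<bullet> q \<noteq> 0" 
  obtains y where "m \<bullet> y = 0" "c \<bullet> y > 0"
    "\<And>u. u \<in> Q \<Longrightarrow> u \<in> Q' \<Longrightarrow> (u \<bullet> y) * (u \<bullet> q) > 0"
    "\<And>u. u \<in> R \<Longrightarrow> u \<notin> Q \<Longrightarrow> u \<notin> Q' \<Longrightarrow> u \<bullet> q \<noteq> 0 \<Longrightarrow> (u \<bullet> y) * (u \<bullet> q) < 0"
proof -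
  obtain x where x: "\<And>u. u \<in> R \<Longrightarrow> u \<bullet> x \<noteq> 0" "c \<bullet> x > 0" "Q = same_side q R x"
    using assms by (auto simp: half_chambers_def)
  obtain z where z: "\<And>u. u \<in> R \<Longrightarrow> u \<bullet> z \<noteq> 0" "c \<bullet> z > 0" "Q' = same_side q R z"
    using assms by (auto simp: half_chambers_def)
  define s where "s = \<bar>m \<bullet> z\<bar>"
  define r where "r = \<bar>m \<bullet> x\<bar>"
  have pos: "s > 0" "r > 0" using x(1) z(1) assms(5) by (auto simp: r_def s_def)
  define y where "y = s *\<^sub>R x + r *\<^sub>R z"
  have uy: "(u \<bullet> y) * (u \<bullet> q) = s * ((u \<bullet> x) * (u \<bullet> q)) + r * ((u \<bullet> z) * (u \<bullet> q))" for u
    by (simp add: y_def inner_add_right algebra_simps)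
  have 1: "(m \<bullet> x) * (m \<bullet> q) > 0" "\<not> (m \<bullet> z) * (m \<bullet> q) > 0"
    using assms(3-5) x(3) z(3) by (auto simp: same_side_def)
  moreover have "(m \<bullet> z) * (m \<bullet> q) \<noteq> 0" using z(1) assms(5,6) by simp
  ultimately have 2: "(m \<bullet> z) * (m \<bullet> q) < 0" by linarith
  show ?thesis
  proof (rule that[of y])
    show "m \<bullet> y = 0"
      using 1(1) 2 by (auto simp: y_def s_def r_def inner_add_right zero_less_mult_iff mult_less_0_iff)
    show "c \<bullet> y > 0"
      using x z pos by (auto simp: y_def inner_add_right intro: add_pos_pos)
  next
    fix u assume "u \<in> Q" "u \<in> Q'"
    then have "(u \<bullet> x) * (u \<bullet> q) > 0" "(u \<bullet> z) * (u \<bullet> q) > 0"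
      using x(3) z(3) by (auto simp: same_side_def)
    then show "(u \<bullet> y) * (u \<bullet> q) > 0"
      unfolding uy using pos by (intro add_pos_pos mult_pos_pos[of s] mult_pos_pos[of r])
  next
    fix u assume u: "u \<in> R" "u \<notin> Q" "u \<notin> Q'" "u \<bullet> q \<noteq> 0"
    then have "\<not> (u \<bullet> x) * (u \<bullet> q) > 0" "\<not> (u \<bullet> z) * (u \<bullet> q) > 0"
      using x(3) z(3) by (auto simp: same_side_def)
    moreover have "(u \<bullet> x) * (u \<bullet> q) \<noteq> 0" "(u \<bullet> z) * (u \<bullet> q) \<noteq> 0"
      using x(1) z(1) u by simp_all
    ultimately have "(u \<bullet> x) * (u \<bullet> q) < 0" "(u \<bullet> z) * (u \<bullet> q) < 0"
      by linarith+
    then show "(u \<bullet> y) * (u \<bullet> q) < 0"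
      unfolding uy using pos by (intro add_neg_neg mult_pos_neg[of s] mult_pos_neg[of r])
  qed
qed

text \<open>Induction on R: the line with the last crossing on c contributes one left pair in the
  last cell and splits at most one left edge of the cell it enters.\<close>

lemma card_left_pairs:
  assumes "finite R" "general_position (insert c R)" "c \<notin> R" "c \<bullet> q = 0" "c \<bullet> d = 0" "q \<bullet> d = 0" "d \<noteq> 0"
    "\<And>u. u \<in> R \<Longrightarrow> u \<bullet> q \<noteq> 0"
  shows "card (left_pairs q c (hit q d) R) \<le> 2 * card R"
  using assms
proof (induction R rule: finite_ranking_induct[where f = "hit q d"])
  case empty
  have "left_pairs q c (hit q d) {} = {}" by (auto simp: left_pairs_def prefixes_def)
  then show ?case by simp
next
  case (insert m S)
  note IH = insert.IH
  let ?f = "hit q d"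
  define R where "R = insert m S"
  note fin = \<open>finite S\<close>
  show ?case
  proof (cases "m \<in> S")
    case True
    then show ?thesis using insert by (simp add: insert_absorb)
  next
    case m: False
    have gp: "general_position (insert c R)" using insert.prems by (simp add: R_def)
    have "card (left_pairs q c ?f S) \<le> 2 * card S"
      using insert.prems by (intro IH) (auto intro: gp_subset)
    \<comment> \<open>\<open>K\<close> collects the left edges other than \<open>m\<close> of the
      cell beyond the last crossing. Those in \<open>K'\<close> also bound the cell just before this
      crossing, so they are the edges cut by \<open>m\<close>.\<close>
    define K where "K = {l\<in>S. R - {l} \<in> half_chambers q c R}"
    define K' where "K' = {l\<in>K. S - {l} \<in> half_chambers q c R}"
    have K': "k = l" if kl: "k \<in> K'" "l \<in> K'" for k l
    proof (rule ccontr)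
      assume ne: "k \<noteq> l"
      have S: "k \<in> S" "l \<in> S" using kl by (auto simp: K'_def K_def)
      have nz: "u \<bullet> q \<noteq> 0" if "u \<in> R" for u using that insert.prems by (auto simp: R_def)
      \<comment> \<open>\<open>w\<close> is the point where \<open>m\<close> crosses
        \<open>c\<close>. It lies on the positive side of every circle of \<open>S\<close>, because
        \<open>m\<close> crosses last and no third circle passes through \<open>w\<close>.\<close>
      define w where "w = ?f m *\<^sub>R q + d"
      have "d \<bullet> w = d \<bullet> d" using insert.prems by (simp add: w_def inner_add_right inner_commute)
      then have w0: "w \<noteq> 0" using insert.prems by auto
      have cw: "c \<bullet> w = 0" using insert.prems by (simp add: w_def inner_add_right)
      have uw: "(u \<bullet> w) * (u \<bullet> q) = (u \<bullet> q)\<^sup>2 * (?f m - ?f u)" if "u \<in> R" for u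
        unfolding w_def by (rule hit_eq) (rule nz[OF that])
      have mw: "m \<bullet> w = 0" using uw[of m] nz[of m] by (simp add: R_def)
      have pw: "(u \<bullet> w) * (u \<bullet> q) > 0" if u: "u \<in> S" for u
      proof -
        have "u \<bullet> w \<noteq> 0"
        proof
          assume "u \<bullet> w = 0"
          moreover obtain t where "w = t *\<^sub>R (c \<times> m)"
            using parallel_cross[OF cw mw] gp_pair[OF gp, of c m] insert.prems by (auto simp: R_def)
          ultimately have "u \<bullet> (c \<times> m) = 0" using w0 by auto
          then show False using gp_triple[OF gp, of c m u] insert.prems u m by (auto simp: R_def)
        qed
        then have "(u \<bullet> w) * (u \<bullet> q) \<noteq> 0" using nz[of u] u by (simp add: R_def)
        moreover have "(u \<bullet> w) * (u \<bullet> q) \<ge> 0"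
          using uw[of u] insert.hyps(2)[OF u] u by (simp add: R_def)
        ultimately show ?thesis by linarith
      qed
      have ex: "\<exists>y. m \<bullet> y = 0 \<and> c \<bullet> y > 0 \<and> (k \<bullet> y) * (k \<bullet> q) < 0 \<and> (l \<bullet> y) * (l \<bullet> q) > 0"
        if k: "k \<in> K'" and l: "l \<in> S" "k \<noteq> l" for k l
      proof -
        have 1: "R - {k} \<in> half_chambers q c R" "S - {k} \<in> half_chambers q c R" "k \<in> S"
          using k by (auto simp: K'_def K_def)
        have 2: "m \<in> R - {k}" "m \<notin> S - {k}" "m \<in> R" using m 1 by (auto simp: R_def)
        show ?thesis
        proof (rule half_chambers_cross_point[OF 1(1,2) 2 nz[OF 2(3)]])
          fix y assume y: "m \<bullet> y = 0" "c \<bullet> y > 0"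
            "\<And>u. u \<in> R - {k} \<Longrightarrow> u \<in> S - {k} \<Longrightarrow> (u \<bullet> y) * (u \<bullet> q) > 0"
            "\<And>u. u \<in> R \<Longrightarrow> u \<notin> R - {k} \<Longrightarrow> u \<notin> S - {k} \<Longrightarrow> u \<bullet> q \<noteq> 0 \<Longrightarrow> (u \<bullet> y) * (u \<bullet> q) < 0"
          have "(k \<bullet> y) * (k \<bullet> q) < 0" using 1(3) nz[of k] by (intro y(4)) (auto simp: R_def)
          moreover have "(l \<bullet> y) * (l \<bullet> q) > 0" using l by (intro y(3)) (auto simp: R_def)
          ultimately show ?thesis using y(1,2) by blast
        qed
      qed
      obtain y where y: "m \<bullet> y = 0" "c \<bullet> y > 0" "(k \<bullet> y) * (k \<bullet> q) < 0" "(l \<bullet> y) * (l \<bullet> q) > 0"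
        using ex[OF kl(1) S(2) ne] by blast
      obtain z where z: "m \<bullet> z = 0" "c \<bullet> z > 0" "(l \<bullet> z) * (l \<bullet> q) < 0" "(k \<bullet> z) * (k \<bullet> q) > 0"
        using ex[OF kl(2) S(1) ne[symmetric]] by blast
      define A B C where "A = m \<bullet> (k \<times> l)" and "B = (m \<bullet> (l \<times> c)) / (k \<bullet> q)"
        and "C = (m \<bullet> (c \<times> k)) / (l \<bullet> q)"
      have q: "k \<bullet> q \<noteq> 0" "l \<bullet> q \<noteq> 0" using nz S by (auto simp: R_def)
      have eq: "A * (c \<bullet> p) + B * ((k \<bullet> p) * (k \<bullet> q)) + C * ((l \<bullet> p) * (l \<bullet> q)) = 0"
        if "m \<bullet> p = 0" for p
        using dependence[OF that, of k l c] q by (simp add: A_def B_def C_def)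
      have "c \<noteq> m" "c \<noteq> k" "c \<noteq> l" "m \<noteq> k" "m \<noteq> l"
        using S m insert.prems by auto
      then have BC: "B \<noteq> 0" "C \<noteq> 0"
        using gp_triple[OF gp, of l c m] gp_triple[OF gp, of c k m] S q by (auto simp: B_def C_def R_def)
      have w: "B * ((k \<bullet> w) * (k \<bullet> q)) + C * ((l \<bullet> w) * (l \<bullet> q)) = 0" using eq[OF mw] cw by simp
      show False
        by (rule sign_patterns_impossible[OF BC w pw[OF S(1)] pw[OF S(2)] eq[OF y(1)] y(2-4) eq[OF z(1)] z(2,4,3)])
    qed
    have cK': "card K' \<le> 1"
      using K' fin by (simp add: card_le_Suc0_iff_eq K'_def K_def)
    have KL: "Pair S ` K \<subseteq> left_pairs q c ?f S"
    proof clarify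
      fix l assume l: "l \<in> K"
      have "(R - {l}) \<inter> S \<in> half_chambers q c S"
        by (rule half_chambers_restrict[of _ q c R]) (use l in \<open>auto simp: K_def R_def\<close>)
      moreover have "(R - {l}) \<inter> S = S - {l}" by (auto simp: R_def m)
      moreover have "S \<in> prefixes ?f S"
      proof -
        have lt: "?f u < 1 + ?f m" if "u \<in> S" for u using insert.hyps(2)[OF that] by linarith
        then have "S = {u\<in>S. ?f u < 1 + ?f m}" by auto
        moreover have "\<forall>u\<in>S. ?f u \<noteq> 1 + ?f m" using lt by fastforce
        ultimately show ?thesis unfolding prefixes_def by blast
      qed
      ultimately show "(S, l) \<in> left_pairs q c ?f S"
        using l by (auto simp: left_pairs_def K_def)
    qed
    \<comment> \<open>New are the pair \<open>(R, m)\<close> and the second halves of split edges. A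
      pair \<open>(S, l)\<close> with \<open>l\<close> in \<open>K\<close> is removed and replaced
      by \<open>(R, l)\<close>, which keeps the count; it reappears only for \<open>l\<close> in
      \<open>K'\<close>. The increase is at most 1 + 1.\<close>
    have sub: "left_pairs q c ?f R \<subseteq>
      insert (R, m) (Pair R ` K \<union> ((left_pairs q c ?f S - Pair S ` K) \<union> Pair S ` K'))"
    proof clarify
      fix Q l assume *: "(Q, l) \<in> left_pairs q c ?f R"
        "(Q, l) \<notin> Pair S ` K'" "(Q, l) \<notin> Pair R ` K" "\<not> (Q = R \<and> l = m)"
      then have Q: "Q \<in> prefixes ?f R" "l \<in> Q" "Q - {l} \<in> half_chambers q c R"
        by (auto simp: left_pairs_def)
      have "Q \<noteq> R" 
      proof
        assume "Q = R"
        then have "l \<in> S" using Q * by (auto simp: R_def)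
        then show False using *(3) Q \<open>Q = R\<close> by (auto simp: K_def)
      qed
      then have mQ: "m \<notin> Q" "Q \<in> prefixes ?f S"
        using prefixes_insert[of Q ?f m S] Q(1) insert.hyps(2) by (auto simp: R_def)
      have "(Q - {l}) \<inter> S \<in> half_chambers q c S"
        by (rule half_chambers_restrict[OF Q(3)]) (auto simp: R_def)
      moreover have "(Q - {l}) \<inter> S = Q - {l}" using prefixes_subset[OF mQ(2)] by blast
      ultimately have "(Q, l) \<in> left_pairs q c ?f S" using Q mQ by (simp add: left_pairs_def)
      moreover have "(Q, l) \<notin> Pair S ` K"
      proof
        assume "(Q, l) \<in> Pair S ` K"
        then have "Q = S" "l \<in> K" by auto
        then have "l \<in> K'" using Q(3) by (simp add: K'_def)
        then show False using *(2) \<open>Q = S\<close> by auto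
      qed
      ultimately show "(Q, l) \<in> left_pairs q c ?f S - Pair S ` K" by blast
    qed
    have finL: "finite (left_pairs q c ?f S)" by (rule finite_left_pairs[OF fin])
    have finK: "finite K" "finite K'" using fin by (auto simp: K_def K'_def)
    have "card (left_pairs q c ?f R) \<le>
      card (insert (R, m) (Pair R ` K \<union> ((left_pairs q c ?f S - Pair S ` K) \<union> Pair S ` K')))"
      by (rule card_mono[OF _ sub]) (use finL finK in auto)
    also have "\<dots> \<le> Suc (card (Pair R ` K \<union> ((left_pairs q c ?f S - Pair S ` K) \<union> Pair S ` K')))"
      using finL finK by (simp add: card_insert_if)
    also have "\<dots> \<le> Suc (card (Pair R ` K) + (card (left_pairs q c ?f S - Pair S ` K) + card (Pair S ` K')))"
      by (intro Suc_le_mono[THEN iffD2] order.trans[OF card_Un_le] add_mono card_Un_le order.refl)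
    also have "\<dots> = Suc (card K + ((card (left_pairs q c ?f S) - card K) + card K'))"
      using finK KL by (simp add: card_Diff_subset card_image inj_on_def)
    also have "\<dots> \<le> Suc (card (left_pairs q c ?f S) + 1)"
      using cK' card_mono[OF finL KL] by (simp add: card_image inj_on_def)
    also have "\<dots> \<le> 2 * card (insert m S)"
      using \<open>card (left_pairs q c ?f S) \<le> 2 * card S\<close> m fin by simp
    finally show ?thesis by (simp add: R_def)
  qed
qed

lemma gp_insert_minus:
  assumes gp: "general_position (insert c R)" and c: "c \<notin> R"
  shows "general_position (insert (-c) R)" "-c \<notin> R"
proof -
  have "c \<noteq> 0" using gp_zero[OF gp] by auto
  have "c \<noteq> -c"
  proof
    assume "c = -c"
    then have "c \<bullet> c = (-c) \<bullet> c" by (rule arg_cong)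
    then show False using \<open>c \<noteq> 0\<close> by simp
  qed
  then show nc: "-c \<notin> R" using gp_pair[OF gp, of c "-c"] by auto
  have 1: "c \<times> a \<noteq> 0" "a \<times> c \<noteq> 0" if "a \<in> R" for a
    using that c gp_pair[OF gp, of c a] gp_pair[OF gp, of a c] by auto
  have 2: "b \<bullet> (c \<times> a) \<noteq> 0" "b \<bullet> (a \<times> c) \<noteq> 0" "c \<bullet> (a \<times> b) \<noteq> 0" if "a \<in> R" "b \<in> R" "a \<noteq> b" for a b
    using that c gp_triple[OF gp, of c a b] gp_triple[OF gp, of a c b] gp_triple[OF gp, of a b c] by auto
  have gpR: "general_position R" by (rule gp_subset[OF gp]) auto
  show "general_position (insert (-c) R)"
    using 1 2 gpR \<open>c \<noteq> 0\<close> unfolding general_position_def by (auto simp: nc)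
qed

text \<open>Unlike in \<open>left_pairs\<close>, the edge on \<open>c\<close> may lie on either half
  circle and \<open>l\<close> may bound the cell from either side.\<close>

definition side_pairs :: "real^3 \<Rightarrow> real^3 \<Rightarrow> (real^3) set \<Rightarrow> ((real^3) set \<times> (real^3)) set" where
  "side_pairs q c R = {(Q, l). (\<exists>y. c \<bullet> y = 0 \<and> (\<forall>u\<in>R. u \<bullet> y \<noteq> 0) \<and> Q = same_side q R y) \<and>
     l \<in> R \<and> flip l Q \<in> half_chambers q c R}"

lemma same_side_prefix:
  assumes "\<And>u. u \<in> R \<Longrightarrow> u \<bullet> q \<noteq> 0" "\<And>u. u \<in> R \<Longrightarrow> u \<bullet> y \<noteq> 0" "y = r *\<^sub>R (t *\<^sub>R q + d)" "r > 0"
  shows "same_side q R y \<in> prefixes (hit q d) R"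
proof -
  have eq: "(u \<bullet> y) * (u \<bullet> q) = r * (u \<bullet> q)\<^sup>2 * (t - hit q d u)" if "u \<in> R" for u
    using hit_eq[OF assms(1)[OF that], of t d] assms(3) by (simp add: mult.assoc)
  have "(u \<bullet> y) * (u \<bullet> q) > 0 \<longleftrightarrow> hit q d u < t" if "u \<in> R" for u
  proof -
    have "r * (u \<bullet> q)\<^sup>2 > 0" using assms(1)[OF that] assms(4) by simp
    from mult_less_cancel_left_pos[OF this, of 0 "t - hit q d u"] show ?thesis
      unfolding eq[OF that] by (simp only: mult_zero_right diff_gt_0_iff_gt)
  qed
  then have "same_side q R y = {u\<in>R. hit q d u < t}" by (auto simp: same_side_def)
  moreover have "\<forall>u\<in>R. hit q d u \<noteq> t"
    using eq assms(1,2) by fastforce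
  ultimately show ?thesis unfolding prefixes_def by blast
qed

lemma prefixes_trivial:
  assumes "finite R"
  shows "R \<in> prefixes f R" "{} \<in> prefixes f R"
proof -
  define T where "T = 1 + (\<Sum>u\<in>R. \<bar>f u\<bar>)"
  have *: "\<bar>f u\<bar> < T" if "u \<in> R" for u
    using member_le_sum[of u R "\<lambda>u. \<bar>f u\<bar>"] that assms by (simp add: T_def)
  have "R = {u\<in>R. f u < T}" "\<forall>u\<in>R. f u \<noteq> T" using * by fastforce+
  then show "R \<in> prefixes f R" unfolding prefixes_def by blast
  have "{} = {u\<in>R. f u < - T}" "\<forall>u\<in>R. f u \<noteq> - T" using * by fastforce+
  then show "{} \<in> prefixes f R" unfolding prefixes_def by blast
qed

text \<open>The plane orthogonal to \<open>c\<close> is spanned by \<open>q\<close> and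
  \<open>c \<times> q\<close>; the sign of the second coordinate selects the half circle. Multiples
  of \<open>q\<close> give the full or the empty prefix.\<close>

lemma same_side_prefixes:
  assumes fin: "finite R" and q: "\<And>u. u \<in> R \<Longrightarrow> u \<bullet> q \<noteq> 0" and y: "\<And>u. u \<in> R \<Longrightarrow> u \<bullet> y \<noteq> 0"
    and c: "c \<bullet> q = 0" "c \<bullet> y = 0" and d: "c \<times> q \<noteq> 0"
  shows "same_side q R y \<in> prefixes (hit q (c \<times> q)) R \<union> prefixes (hit q (- (c \<times> q))) R"
proof -
  let ?d = "c \<times> q"
  have "q \<bullet> q \<noteq> 0" using d by auto
  define s where "s = (q \<bullet> y) / (q \<bullet> q)"
  have "q \<bullet> (y - s *\<^sub>R q) = 0" using \<open>q \<bullet> q \<noteq> 0\<close> by (simp add: s_def inner_diff_right)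
  moreover have "c \<bullet> (y - s *\<^sub>R q) = 0" using c by (simp add: inner_diff_right)
  ultimately obtain r where "y - s *\<^sub>R q = r *\<^sub>R ?d" using parallel_cross d by blast
  then have yr: "y = s *\<^sub>R q + r *\<^sub>R ?d" by (simp add: algebra_simps)
  consider "r > 0" | "r < 0" | "r = 0" by linarith
  then show ?thesis
  proof cases
    case 1
    then have "y = r *\<^sub>R ((s / r) *\<^sub>R q + ?d)" using yr by (simp add: scaleR_add_right)
    then show ?thesis using same_side_prefix[OF q y _ 1] by blast
  next
    case 2
    then have yr': "y = (- r) *\<^sub>R ((s / (- r)) *\<^sub>R q + (- ?d))" using yr by (simp add: algebra_simps)
    have "- r > 0" using 2 by simp
    with same_side_prefix[OF q y yr'] show ?thesis by blast
  next
    case 3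
    have uy: "(u \<bullet> y) * (u \<bullet> q) = s * (u \<bullet> q)\<^sup>2" for u
      using yr 3 by (simp add: power2_eq_square)
    have "same_side q R y = R \<or> same_side q R y = {}"
      using q by (cases "s > 0") (auto simp: same_side_def uy zero_less_mult_iff)
    then show ?thesis using prefixes_trivial[OF fin] by auto
  qed
qed

text \<open>Two half circles and two positions of \<open>l\<close> relative to the edge give four
  families of left pairs, each of size at most \<open>2 * card R\<close>.\<close>

lemma card_side_pairs:
  assumes fin: "finite R" and gp: "general_position (insert c R)" and c: "c \<notin> R" "c \<bullet> q = 0"
    and q: "\<And>u. u \<in> R \<Longrightarrow> u \<bullet> q \<noteq> 0"
  shows "card (side_pairs q c R) \<le> 8 * card R"
proof (cases "R = {}")
  case True
  then have "side_pairs q c R = {}" by (auto simp: side_pairs_def)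
  then show ?thesis by simp
next
  case False
  define d where "d = c \<times> q"
  have "q \<noteq> 0" using False q by force
  moreover have "c \<noteq> 0" using gp_zero[OF gp] by auto
  ultimately have d0: "d \<noteq> 0" using norm_cross_dot[of c q] c(2) by (auto simp: d_def)
  have dd: "c \<bullet> d = 0" "q \<bullet> d = 0" by (simp_all add: d_def dot_cross_self)
  let ?L = "\<lambda>g. left_pairs q c (hit q g) R"
  let ?M = "\<lambda>g. (\<lambda>(Q, l). (R - Q, l)) ` left_pairs q (-c) (hit q g) R"
  have L: "card (?L d) \<le> 2 * card R" "card (?L (-d)) \<le> 2 * card R"
    using fin gp c q dd d0 by (intro card_left_pairs; simp)+
  have M': "card (left_pairs q (-c) (hit q d) R) \<le> 2 * card R"
    "card (left_pairs q (-c) (hit q (-d)) R) \<le> 2 * card R"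
    using fin gp_insert_minus[OF gp c(1)] c q dd d0 by (intro card_left_pairs; simp)+
  have M: "card (?M d) \<le> 2 * card R" "card (?M (-d)) \<le> 2 * card R"
    using M' card_image_le[OF finite_left_pairs[OF fin]] le_trans by blast+
  \<comment> \<open>A right edge becomes a left edge under the antipodal map, which complements
    \<open>Q\<close> and reverses \<open>c\<close> and the half circle.\<close>
  have *: "(Q, l) \<in> ?L g \<union> ?M (-g)"
    if Q: "Q \<in> prefixes (hit q g) R" and l: "l \<in> R" "flip l Q \<in> half_chambers q c R" for Q l g
  proof (cases "l \<in> Q")
    case True
    then show ?thesis using Q l by (simp add: left_pairs_def flip_def)
  next
    case lQ: False
    then have "R - insert l Q \<in> half_chambers q (-c) R"
      using half_chambers_antipode[OF l(2)] q by (simp add: flip_def)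
    moreover have "R - insert l Q = (R - Q) - {l}" by blast
    moreover have "R - Q \<in> prefixes (hit q (-g)) R"
      using prefixes_complement[OF Q] by (simp add: hit_minus[abs_def])
    ultimately have "(R - Q, l) \<in> left_pairs q (-c) (hit q (-g)) R"
      using l lQ by (simp add: left_pairs_def)
    moreover have "(Q, l) = (\<lambda>(Q, l). (R - Q, l)) (R - Q, l)"
      using prefixes_subset[OF Q] by auto
    ultimately show ?thesis by blast
  qed
  have sub: "side_pairs q c R \<subseteq> (?L d \<union> ?M (-d)) \<union> (?L (-d) \<union> ?M d)"
  proof clarify
    fix Q l assume Ql: "(Q, l) \<in> side_pairs q c R" "(Q, l) \<notin> ?L (-d)" "(Q, l) \<notin> ?M d" "(Q, l) \<notin> ?M (-d)"
    then obtain y where y: "c \<bullet> y = 0" "\<And>u. u \<in> R \<Longrightarrow> u \<bullet> y \<noteq> 0" "Q = same_side q R y"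
      and l: "l \<in> R" "flip l Q \<in> half_chambers q c R"
      by (auto simp: side_pairs_def)
    have "Q \<in> prefixes (hit q d) R \<union> prefixes (hit q (-d)) R"
      unfolding y(3) d_def using same_side_prefixes[OF fin q y(2) c(2) y(1)] d0
      by (simp add: d_def)
    then show "(Q, l) \<in> ?L d" using *[OF _ l, of d] *[OF _ l, of "-d"] Ql by auto
  qed
  have "card (side_pairs q c R) \<le> card ((?L d \<union> ?M (-d)) \<union> (?L (-d) \<union> ?M d))"
    by (rule card_mono[OF _ sub]) (use finite_left_pairs[OF fin] in auto)
  also have "\<dots> \<le> (card (?L d) + card (?M (-d))) + (card (?L (-d)) + card (?M d))"
    by (intro order.trans[OF card_Un_le] add_mono card_Un_le)
  finally show ?thesis using L M by linarith
qed

lemma finite_side_pairs: "finite R \<Longrightarrow> finite (side_pairs q c R)"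
  by (rule finite_subset[of _ "Sigma (Pow R) (\<lambda>_. R)"])
    (auto simp: side_pairs_def same_side_def)

lemma zone:
  assumes gp: "general_position U" and c: "c \<in> U"
  shows "card {(A, l). A \<in> chambers U \<and> c \<in> edges U A \<and> l \<in> edges U A \<and> l \<noteq> c} \<le> 16 * (card U - 1)"
    (is "card ?Z \<le> _")
proof (cases "\<exists>A\<in>chambers U. c \<in> edges U A")
  case False
  then have "?Z = {}" by auto
  then show ?thesis by (simp only: card.empty le0)
next
  case True
  then obtain A0 where A0: "A0 \<in> chambers U" "c \<in> edges U A0" by blast
  \<comment> \<open>The base point is an inner point of any edge on \<open>c\<close>, so no circle
    other than \<open>c\<close> contains it.\<close>
  obtain q where q: "c \<bullet> q = 0" "positive U q = A0 - {c}" "\<And>u. u \<in> U \<Longrightarrow> u \<noteq> c \<Longrightarrow> u \<bullet> q \<noteq> 0"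
    using edge_point[OF A0] by blast
  define R where "R = U - {c}"
  have U: "U = insert c R" and cR: "c \<notin> R" using c by (auto simp: R_def)
  have fin: "finite R" using gp_finite[OF gp] by (simp add: R_def)
  have qR: "u \<bullet> q \<noteq> 0" if "u \<in> R" for u using q(3) that by (auto simp: R_def)
  have gp': "general_position (insert c R)" using gp U by simp
  have T: "card (side_pairs q c R) \<le> 8 * card R" "card (side_pairs q (-c) R) \<le> 8 * card R"
    using card_side_pairs[OF fin gp' cR q(1) qR]
      card_side_pairs[OF fin gp_insert_minus[OF gp' cR] _ qR] q(1) by auto
  define rel where "rel Q = {u\<in>R. u \<in> Q \<longleftrightarrow> u \<bullet> q > 0}" for Q
  have rel_pos: "rel (positive U x) = same_side q R x" if "\<And>u. u \<in> R \<Longrightarrow> u \<bullet> x \<noteq> 0" for x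
  proof -
    have "u \<in> positive U x \<longleftrightarrow> u \<bullet> x > 0" if "u \<in> R" for u
      using that by (auto simp: positive_def R_def)
    moreover have "(u \<bullet> x > 0 \<longleftrightarrow> u \<bullet> q > 0) \<longleftrightarrow> (u \<bullet> x) * (u \<bullet> q) > 0" if "u \<in> R" for u
      using that qR[OF that] \<open>\<And>u. u \<in> R \<Longrightarrow> u \<bullet> x \<noteq> 0\<close>[OF that] by (auto simp: zero_less_mult_iff)
    ultimately show ?thesis unfolding rel_def same_side_def by blast
  qed
  \<comment> \<open>The first component records the side of \<open>c\<close>; the two sides together
    turn 8 into 16.\<close>
  define h where "h = (\<lambda>(A, l :: real^3). (c \<in> A, rel A, l))"
  have "inj_on h ?Z"
  proof (rule inj_onI, clarify)
    fix A l B k assume *: "h (A, l) = h (B, k)" "A \<in> chambers U" "B \<in> chambers U"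
    then have "rel A = rel B" "c \<in> A \<longleftrightarrow> c \<in> B" "l = k" by (auto simp: h_def)
    then have "u \<in> A \<longleftrightarrow> u \<in> B" if "u \<in> R" for u using that by (auto simp: rel_def set_eq_iff)
    then have "A = B"
      using \<open>c \<in> A \<longleftrightarrow> c \<in> B\<close> chambers_subset[OF *(2)] chambers_subset[OF *(3)] U by blast
    then show "A = B \<and> l = k" using \<open>l = k\<close> by simp
  qed
  have sub: "h ` ?Z \<subseteq> Pair True ` side_pairs q c R \<union> Pair False ` side_pairs q (-c) R"
  proof (rule image_subsetI, clarify)
    fix A l assume A: "A \<in> chambers U" "c \<in> edges U A" "l \<in> edges U A" "l \<noteq> c"
      and notin: "h (A, l) \<notin> Pair False ` side_pairs q (-c) R"
    obtain y where y: "c \<bullet> y = 0" "positive U y = A - {c}" "\<And>u. u \<in> U \<Longrightarrow> u \<noteq> c \<Longrightarrow> u \<bullet> y \<noteq> 0"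
      using edge_point[OF A(1,2)] by blast
    have "rel A = rel (positive U y)" unfolding y(2) by (auto simp: rel_def R_def)
    then have rA: "rel A = same_side q R y" using rel_pos[of y] y(3) by (simp add: R_def)
    have l: "l \<in> R" using A by (auto simp: R_def edges_def)
    have "flip l A \<in> chambers U" using A by (simp add: edges_def)
    then obtain x where x: "\<And>u. u \<in> U \<Longrightarrow> u \<bullet> x \<noteq> 0" "flip l A = positive U x"
      using chambersE by blast
    have "flip l (rel A) = rel (flip l A)" using l by (auto simp: flip_def rel_def)
    also have "\<dots> = same_side q R x" unfolding x(2) by (rule rel_pos) (use x(1) in \<open>simp add: R_def\<close>)
    finally have f: "flip l (rel A) = same_side q R x" .
    have cx: "c \<in> A \<longleftrightarrow> c \<bullet> x > 0"
    proof -
      have "c \<in> A \<longleftrightarrow> c \<in> flip l A" using A(4) by (auto simp: flip_def)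
      then show ?thesis unfolding x(2) using c by (simp add: positive_def)
    qed
    have xR: "\<forall>u\<in>R. u \<bullet> x \<noteq> 0" using x(1) by (simp add: R_def)
    have yR: "\<forall>u\<in>R. u \<bullet> y \<noteq> 0" using y(3) by (auto simp: R_def)
    show "h (A, l) \<in> Pair True ` side_pairs q c R"
    proof (cases "c \<in> A")
      case True
      then have "flip l (rel A) \<in> half_chambers q c R"
        unfolding half_chambers_def using f cx xR by blast
      then have "(rel A, l) \<in> side_pairs q c R"
        unfolding side_pairs_def using rA y(1) yR l by blast
      then show ?thesis using True by (simp add: h_def)
    next
      case False
      then have "- c \<bullet> x > 0" using cx x(1)[OF c] by simp
      then have "flip l (rel A) \<in> half_chambers q (-c) R"
        unfolding half_chambers_def using f xR by blast
      moreover have "- c \<bullet> y = 0" using y(1) by simp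
      ultimately have "(rel A, l) \<in> side_pairs q (-c) R"
        unfolding side_pairs_def using rA yR l by blast
      then show ?thesis using False notin by (simp add: h_def)
    qed
  qed
  have "card ?Z = card (h ` ?Z)" using \<open>inj_on h ?Z\<close> by (simp add: card_image)
  also have "\<dots> \<le> card (Pair True ` side_pairs q c R \<union> Pair False ` side_pairs q (-c) R)"
    by (rule card_mono[OF _ sub]) (use finite_side_pairs[OF fin] in auto)
  also have "\<dots> \<le> card (side_pairs q c R) + card (side_pairs q (-c) R)"
    by (rule order.trans[OF card_Un_le]) (simp add: card_image inj_on_def)
  finally show ?thesis using T fin c by (simp add: R_def)
qed

section \<open>From zones to visible pairs of vertices\<close>

definition sep :: "(real^3) set \<Rightarrow> real^3 \<Rightarrow> real^3 \<Rightarrow> (real^3) set" where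
  "sep U x y = {u\<in>U. (u \<bullet> x) * (u \<bullet> y) < 0}"

definition disjoint_vertices :: "(real^3) set \<Rightarrow> (((real^3) \<times> (real^3)) \<times> ((real^3) \<times> (real^3))) set" where
  "disjoint_vertices U = {(v, w). v \<in> opairs U \<and> w \<in> opairs U \<and> ends v \<inter> ends w = {}}"

text \<open>Lying on a common cell is encoded by the absence of a separating circle.\<close>

definition visible_pairs :: "(real^3) set \<Rightarrow> (((real^3) \<times> (real^3)) \<times> ((real^3) \<times> (real^3))) set" where
  "visible_pairs U = {(v, w)\<in>disjoint_vertices U. sep U (vpt v) (vpt w) = {}}"

lemma chambers_at_vertex:
  assumes gp: "general_position U" and v: "v \<in> opairs U"
  shows "{A\<in>chambers U. v \<in> corners U A} = (\<lambda>S. positive U (vpt v) \<union> S) ` Pow (ends v)"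
    (is "?L = ?f ` _")
proof
  have disj: "positive U (vpt v) \<inter> ends v = {}"
    using ends_vpt[of _ v] by (auto simp: positive_def)
  show "?L \<subseteq> ?f ` Pow (ends v)"
  proof clarify
    fix A assume "A \<in> chambers U" "v \<in> corners U A"
    then have "A = ?f (A \<inter> ends v)" by (auto simp: corners_def)
    then show "A \<in> ?f ` Pow (ends v)" by blast
  qed
  show "?f ` Pow (ends v) \<subseteq> ?L"
  proof clarify
    fix S assume S: "S \<subseteq> ends v"
    have "?f S - ends v = positive U (vpt v)" using disj S by blast
    moreover have "?f S \<subseteq> U" using S ends_opairs(1)[OF v] by (auto simp: positive_def)
    ultimately show "?f S \<in> chambers U \<and> v \<in> corners U (?f S)"
      using vertex_chambers[OF gp v, of "?f S"] v by (simp add: corners_def)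
  qed
qed

lemma card_chambers_at_vertex:
  assumes gp: "general_position U" and v: "v \<in> opairs U"
  shows "card {A\<in>chambers U. v \<in> corners U A} = 4"
proof -
  have disj: "positive U (vpt v) \<inter> ends v = {}"
    using ends_vpt[of _ v] by (auto simp: positive_def)
  then have "inj_on (\<lambda>S. positive U (vpt v) \<union> S) (Pow (ends v))"
    by (intro inj_onI) blast
  then show ?thesis
    unfolding chambers_at_vertex[OF assms]
    using ends_opairs(2)[OF v] by (simp add: card_image card_Pow ends_def)
qed

lemma sum_card_corners:
  assumes gp: "general_position U"
  shows "(\<Sum>A\<in>chambers U. card (corners U A)) = 4 * card (opairs U)"
proof -
  have fin: "finite U" using gp by (rule gp_finite)
  have "(\<Sum>A\<in>chambers U. card {v\<in>opairs U. v \<in> corners U A}) = 4 * card (opairs U)"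
    by (rule sum_multicount)
      (use finite_chambers[OF fin] finite_opairs[OF fin] card_chambers_at_vertex[OF gp] in auto)
  moreover have "{v\<in>opairs U. v \<in> corners U A} = corners U A" for A by (auto simp: corners_def)
  ultimately show ?thesis by simp
qed

text \<open>The two edges at \<open>v\<close> have two corners each and share only \<open>v\<close>,
  so 2 + 2 - 1 corners meet \<open>ends v\<close>.\<close>

lemma card_disjoint_corners:
  assumes gp: "general_position U" and A: "A \<in> chambers U" and three: "card U \<ge> 3"
    and v: "v \<in> corners U A"
  shows "card {w\<in>corners U A. ends v \<inter> ends w = {}} + 3 \<le> card (edges U A)"
proof -
  have two: "card U \<ge> 2" using three by simp
  have fin: "finite (corners U A)" by (rule finite_corners[OF gp_finite[OF gp]])
  obtain a b where ab: "ends v = {a, b}" "a \<noteq> b"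
    using v by (cases v) (auto simp: corners_def opairs_def ends_def)
  then have "a \<in> edges U A" "b \<in> edges U A"
    using corner_edges[OF gp v chambers_subset[OF A]] by auto
  then have 2: "card {w\<in>corners U A. a \<in> ends w} = 2" "card {w\<in>corners U A. b \<in> ends w} = 2"
    using edge_card_corners[OF gp A _ two] by auto
  have "{w\<in>corners U A. a \<in> ends w} \<inter> {w\<in>corners U A. b \<in> ends w} \<subseteq> {v}"
  proof clarify
    fix w1 w2 assume w: "(w1, w2) \<in> corners U A" "a \<in> ends (w1, w2)" "b \<in> ends (w1, w2)"
    then have "ends (w1, w2) = ends v" using ab by (auto simp: ends_def)
    then show "(w1, w2) = v" using corners_eq[OF gp three w(1) v] by simp
  qed
  then have "card ({w\<in>corners U A. a \<in> ends w} \<inter> {w\<in>corners U A. b \<in> ends w}) \<le> card {v}"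
    by (intro card_mono) auto
  then have "3 \<le> card ({w\<in>corners U A. a \<in> ends w} \<union> {w\<in>corners U A. b \<in> ends w})"
    using card_Un_Int[of "{w\<in>corners U A. a \<in> ends w}" "{w\<in>corners U A. b \<in> ends w}"] fin 2 by simp
  moreover have "{w\<in>corners U A. a \<in> ends w} \<union> {w\<in>corners U A. b \<in> ends w}
      = {w\<in>corners U A. ends v \<inter> ends w \<noteq> {}}"
    using ab by auto
  moreover have "card (corners U A) = card {w\<in>corners U A. ends v \<inter> ends w = {}}
      + card {w\<in>corners U A. ends v \<inter> ends w \<noteq> {}}"
    by (subst card_Un_disjoint[symmetric]) (use fin in \<open>auto intro: arg_cong[where f = card]\<close>)
  ultimately show ?thesis using card_corners_edges[OF gp A two] by simp
qed

lemma card_visible_pairs: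
  assumes gp: "general_position U"
  shows "card (visible_pairs U) \<le> 8 * (card U * (card U - 1))"
proof (cases "card U \<ge> 3")
  case False
  have "visible_pairs U = {}"
  proof (rule ccontr)
    assume "visible_pairs U \<noteq> {}"
    then obtain v w where vw: "v \<in> opairs U" "w \<in> opairs U" "ends v \<inter> ends w = {}"
      by (auto simp: visible_pairs_def disjoint_vertices_def)
    then have "card (ends v \<union> ends w) = 4"
      by (subst card_Un_disjoint) (auto simp: ends_opairs(2)[OF vw(1)] ends_opairs(2)[OF vw(2)], simp_all add: ends_def)
    moreover have "card (ends v \<union> ends w) \<le> card U"
      using ends_opairs(1) vw gp_finite[OF gp] by (intro card_mono) blast+
    ultimately show False using False by simp
  qed
  then show ?thesis by simp
next
  case three: True
  have two: "card U \<ge> 2" using three by simp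
  have fin: "finite U" using gp by (rule gp_finite)
  let ?D = "\<lambda>A. Sigma (corners U A) (\<lambda>v. {w\<in>corners U A. ends v \<inter> ends w = {}})"
  have finD: "finite (?D A)" for A using finite_corners[OF fin] by auto
  have finC: "finite (chambers U)" by (rule finite_chambers[OF fin])
  have 1: "card (visible_pairs U) \<le> (\<Sum>A\<in>chambers U. card (?D A))"
  proof -
    \<comment> \<open>A common cell takes its signs from \<open>v\<close>, and on the two circles
      through \<open>v\<close> from \<open>w\<close>, where they do not vanish since the ends are
      disjoint.\<close>
    define h where "h = (\<lambda>(v, w). (positive U (vpt v) \<union> (ends v \<inter> positive U (vpt w)),
      (v, w)))"
    have "h ` visible_pairs U \<subseteq> Sigma (chambers U) ?D"
    proof (rule image_subsetI)
      fix x assume "x \<in> visible_pairs U"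
      then obtain v w where x: "x = (v, w)" and v: "v \<in> opairs U" and w: "w \<in> opairs U"
        and disj: "ends v \<inter> ends w = {}" and s: "sep U (vpt v) (vpt w) = {}"
        by (auto simp: visible_pairs_def disjoint_vertices_def)
      let ?A = "positive U (vpt v) \<union> (ends v \<inter> positive U (vpt w))"
      have Av: "?A - ends v = positive U (vpt v)" using ends_vpt[of _ v] by (auto simp: positive_def)
      have "u \<in> ?A - ends w \<longleftrightarrow> u \<in> positive U (vpt w)" if u: "u \<in> U" for u
      proof -
        have "\<not> (u \<bullet> vpt v) * (u \<bullet> vpt w) < 0" using s u by (auto simp: sep_def)
        then show ?thesis
          using u vpt_zero_iff[OF gp v u] vpt_zero_iff[OF gp w u] disj
          by (auto simp: positive_def mult_less_0_iff)
      qed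
      then have Aw: "?A - ends w = positive U (vpt w)" by (auto simp: positive_def)
      have "?A \<subseteq> U" by (auto simp: positive_def)
      then have "?A \<in> chambers U" using vertex_chambers[OF gp v _ Av] by simp
      then show "h x \<in> Sigma (chambers U) ?D"
        using v w disj Av Aw by (simp add: x h_def corners_def)
    qed
    moreover have "inj_on h (visible_pairs U)" by (auto simp: h_def inj_on_def)
    ultimately have "card (visible_pairs U) \<le> card (Sigma (chambers U) ?D)"
      using finC finD by (intro card_inj_on_le[of h]) auto
    then show ?thesis using finC finD by (simp add: card_SigmaI)
  qed
  have 2: "card (?D A) + 3 * card (corners U A) \<le> card (edges U A) * card (edges U A)"
    if A: "A \<in> chambers U" for A
  proof -
    have "card (?D A) + 3 * card (corners U A)
        = (\<Sum>v\<in>corners U A. card {w\<in>corners U A. ends v \<inter> ends w = {}} + 3)"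
      using finite_corners[OF fin] by (simp add: card_SigmaI sum.distrib)
    also have "\<dots> \<le> (\<Sum>v\<in>corners U A. card (edges U A))"
      using card_disjoint_corners[OF gp A three] by (intro sum_mono) auto
    also have "\<dots> = card (edges U A) * card (edges U A)"
      using card_corners_edges[OF gp A two] by simp
    finally show ?thesis .
  qed
  have 3: "(\<Sum>A\<in>chambers U. card (edges U A) * (card (edges U A) - 1)) \<le> 16 * (card U * (card U - 1))"
  proof -
    let ?Z = "\<lambda>c. {(A, l). A \<in> chambers U \<and> c \<in> edges U A \<and> l \<in> edges U A \<and> l \<noteq> c}"
    have "finite (?Z c)" for c
      by (rule finite_subset[of _ "Sigma (chambers U) (\<lambda>_. U)"]) (use finC fin in \<open>auto simp: edges_def\<close>)
    then have "card (Sigma U ?Z) = (\<Sum>c\<in>U. card (?Z c))" using fin by (simp add: card_SigmaI)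
    also have "\<dots> \<le> (\<Sum>c\<in>U. 16 * (card U - 1))" by (intro sum_mono zone[OF gp])
    finally have "card (Sigma U ?Z) \<le> 16 * (card U * (card U - 1))" by simp
    moreover have "card (Sigma (chambers U) (\<lambda>A. opairs (edges U A))) = card (Sigma U ?Z)"
      by (rule bij_betw_same_card[of "\<lambda>(A, (c, l)). (c, (A, l))"],
          rule bij_betwI[of _ _ _ "\<lambda>(c, (A, l)). (A, (c, l))"])
        (auto simp: opairs_def edges_def)
    moreover have "card (Sigma (chambers U) (\<lambda>A. opairs (edges U A)))
        = (\<Sum>A\<in>chambers U. card (edges U A) * (card (edges U A) - 1))"
      using finC finite_edges[OF fin] finite_opairs[OF finite_edges[OF fin]]
      by (simp add: card_SigmaI card_opairs)
    ultimately show ?thesis by simp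
  qed
  have 4: "(\<Sum>A\<in>chambers U. card (corners U A)) = 4 * (card U * (card U - 1))"
    using sum_card_corners[OF gp] card_opairs[OF fin] by simp
  have sq: "card (edges U A) * card (edges U A) = card (edges U A) * (card (edges U A) - 1) + card (corners U A)"
    if "A \<in> chambers U" for A
    using card_corners_edges[OF gp that two] by (cases "card (edges U A)") auto
  \<comment> \<open>With m edges and m corners a cell satisfies D + 3 m <= m^2 = m (m - 1) + m.
    Summation gives D <= 16 N - 2 * 4 N = 8 N for N = \<open>card U * (card U - 1)\<close>.\<close>
  have "(\<Sum>A\<in>chambers U. card (?D A)) + 3 * (\<Sum>A\<in>chambers U. card (corners U A))
      \<le> (\<Sum>A\<in>chambers U. card (edges U A) * card (edges U A))"
    using sum_mono[OF 2, of "chambers U"] by (simp add: sum.distrib sum_distrib_left)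
  also have "\<dots> = (\<Sum>A\<in>chambers U. card (edges U A) * (card (edges U A) - 1)) + (\<Sum>A\<in>chambers U. card (corners U A))"
    by (simp add: sq sum.distrib cong: sum.cong)
  finally show ?thesis using 1 3 4 by linarith
qed

section \<open>Counting chambers and sampling\<close>

text \<open>Adding a circle \<open>c\<close> to r others raises the number of cells by the number of
  cells that it cuts, and it cuts at least as many as it has vertices, namely 2 r.\<close>

lemma card_chambers_ge:
  assumes "general_position U"
  shows "card U * (card U - 1) \<le> card (chambers U)"
  using gp_finite[OF assms] assms
proof (induction U rule: finite_induct)
  case (insert c R)
  let ?U = "insert c R"
  note gp = insert.prems
  have gpR: "general_position R" by (rule gp_subset[OF gp]) auto
  show ?case
  proof (cases "R = {}")
    case False
    have finC: "finite (chambers ?U)" using gp finite_chambers gp_finite by blast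
    \<comment> \<open>\<open>X\<close> and \<open>Y'\<close> are the two sides of \<open>c\<close>,
      both read as sign vectors over \<open>R\<close>. Their union contains all old cells, and their
      intersection consists of the cells cut by \<open>c\<close>.\<close>
    define X Y where "X = {Q\<in>chambers ?U. c \<notin> Q}" and "Y = {Q\<in>chambers ?U. c \<in> Q}"
    define Y' where "Y' = (\<lambda>Q. Q - {c}) ` Y"
    have fin: "finite X" "finite Y" "finite Y'" using finC by (auto simp: X_def Y_def Y'_def)
    have "chambers ?U = X \<union> Y" "X \<inter> Y = {}" by (auto simp: X_def Y_def)
    then have 1: "card (chambers ?U) = card X + card Y" using fin by (simp add: card_Un_disjoint)
    have "inj_on (\<lambda>Q. Q - {c}) Y" by (auto simp: inj_on_def Y_def)
    then have 2: "card Y = card Y'" by (simp add: Y'_def card_image)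
    have 3: "chambers R \<subseteq> X \<union> Y'"
    proof
      fix Q assume "Q \<in> chambers R"
      then obtain x where x: "\<And>u. u \<in> R \<Longrightarrow> u \<bullet> x \<noteq> 0" "Q = positive R x"
        using chambersE by blast
      then have "x \<noteq> 0" using False by force
      then have "positive ?U x \<union> {} \<in> chambers ?U" by (rule free_signs[OF gp]) simp
      then have in_U: "positive ?U x \<in> chambers ?U" by simp
      show "Q \<in> X \<union> Y'"
      proof (cases "c \<bullet> x > 0")
        case True
        then have "positive ?U x = insert c Q" using x(2) by (auto simp: positive_def)
        moreover have "c \<notin> Q" using insert.hyps x(2) by (simp add: positive_def)
        ultimately have "insert c Q \<in> Y" "Q = insert c Q - {c}" using in_U by (auto simp: Y_def)
        then show ?thesis unfolding Y'_def by blast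
      next
        case False
        then have "positive ?U x = Q" using x(2) by (auto simp: positive_def)
        moreover have "c \<notin> Q" using insert.hyps x(2) by (simp add: positive_def)
        ultimately show ?thesis using in_U by (simp add: X_def)
      qed
    qed
    \<comment> \<open>The \<open>2 * card R\<close> vertices on \<open>c\<close> are
      \<open>c \<times> l\<close> and \<open>l \<times> c\<close>. Each is sent to the edge of
      \<open>c\<close> following it in one fixed orientation: \<open>l\<close> turns negative after
      \<open>c \<times> l\<close> and positive after the antipode.\<close>
    define g where "g = (\<lambda>(l, s). if s then positive ?U (c \<times> l) else insert l (positive ?U (l \<times> c)))"
    have g_in: "g (l, s) \<in> X \<inter> Y'" if l: "l \<in> R" for l s
    proof -
      have cl: "c \<noteq> l" using l insert.hyps by auto
      then have nz: "c \<times> l \<noteq> 0" "l \<times> c \<noteq> 0" using gp_pair[OF gp] l by auto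
      have zero: "c \<bullet> (c \<times> l) = 0" "l \<bullet> (c \<times> l) = 0" "c \<bullet> (l \<times> c) = 0" "l \<bullet> (l \<times> c) = 0"
        by (simp_all add: dot_cross_self)
      have "positive ?U (c \<times> l) \<union> {} \<in> chambers ?U" "positive ?U (c \<times> l) \<union> {c} \<in> chambers ?U"
        "positive ?U (l \<times> c) \<union> {l} \<in> chambers ?U" "positive ?U (l \<times> c) \<union> {c, l} \<in> chambers ?U"
        using l zero by (intro free_signs[OF gp] nz; simp)+
      moreover have "c \<notin> positive ?U (c \<times> l)" "c \<notin> positive ?U (l \<times> c)"
        using zero by (auto simp: positive_def)
      ultimately have "g (l, s) \<in> chambers ?U" "insert c (g (l, s)) \<in> chambers ?U" "c \<notin> g (l, s)"
        using cl by (auto simp: g_def insert_commute)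
      then have "g (l, s) \<in> X" "insert c (g (l, s)) \<in> Y" "g (l, s) = insert c (g (l, s)) - {c}"
        by (auto simp: X_def Y_def)
      then show ?thesis unfolding Y'_def by blast
    qed
    have "inj_on g (Sigma R (\<lambda>_. UNIV))"
    proof (rule inj_onI, clarify)
      fix l s k r assume lk: "l \<in> R" "k \<in> R" and eq: "g (l, s) = g (k, r)"
      have self: "l \<in> g (l, s) \<longleftrightarrow> \<not> s" for l s by (auto simp: g_def positive_def dot_cross_self)
      have other: "k \<in> g (l, s) \<longleftrightarrow> (if s then k \<bullet> (c \<times> l) > 0 else k \<bullet> (c \<times> l) < 0)"
        if "k \<noteq> l" "k \<in> R" for k l s
        using that cross_skew[of l c] by (auto simp: g_def positive_def)
      have "l = k"
      proof (rule ccontr)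
        assume ne: "l \<noteq> k"
        have "k \<bullet> (c \<times> l) \<noteq> 0" using gp_triple[OF gp, of c l k] lk insert.hyps ne by auto
        then have X: "l \<bullet> (c \<times> k) < 0 \<longleftrightarrow> k \<bullet> (c \<times> l) > 0" "l \<bullet> (c \<times> k) > 0 \<longleftrightarrow> k \<bullet> (c \<times> l) < 0"
          "\<not> k \<bullet> (c \<times> l) > 0 \<longleftrightarrow> k \<bullet> (c \<times> l) < 0"
          using triple_swap[of k c l] by auto
        have "l \<in> g (k, r) \<longleftrightarrow> \<not> s" "k \<in> g (l, s) \<longleftrightarrow> \<not> r"
          unfolding eq[symmetric] by (rule self) (unfold eq, rule self)
        then have "\<not> s \<longleftrightarrow> (if r then l \<bullet> (c \<times> k) > 0 else l \<bullet> (c \<times> k) < 0)"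
          "\<not> r \<longleftrightarrow> (if s then k \<bullet> (c \<times> l) > 0 else k \<bullet> (c \<times> l) < 0)"
          using other[OF ne lk(1), of r] other[OF ne[symmetric] lk(2), of s] by blast+
        then show False using X by (cases s; cases r) auto
      qed
      then show "l = k \<and> s = r" using self[of l s] self[of k r] unfolding eq by simp
    qed
    then have "card (Sigma R (\<lambda>_. UNIV :: bool set)) \<le> card (X \<inter> Y')"
      using g_in fin by (intro card_inj_on_le[of g]) auto
    then have "2 * card R \<le> card (X \<inter> Y')" using insert.hyps by (simp add: card_SigmaI)
    moreover have "card (chambers R) \<le> card (X \<union> Y')" using 3 fin by (intro card_mono) auto
    moreover have "card X + card Y' = card (X \<union> Y') + card (X \<inter> Y')"
      using fin by (intro card_Un_Int) auto
    moreover have "card R * (card R - 1) \<le> card (chambers R)" using insert.IH gpR by simp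
    moreover have "card ?U * (card ?U - 1) = card R * (card R - 1) + 2 * card R"
      using insert.hyps by (cases "card R") auto
    ultimately show ?thesis using 1 2 by linarith
  qed simp
qed simp

section \<open>Vertices that share a circle\<close>

lemma sep_scale:
  assumes "r > 0"
  shows "sep U p (r *\<^sub>R x) = sep U p x"
proof -
  have "(u \<bullet> p) * (u \<bullet> (r *\<^sub>R x)) < 0 \<longleftrightarrow> (u \<bullet> p) * (u \<bullet> x) < 0" for u
    using assms mult_less_cancel_left_pos[of r "(u \<bullet> p) * (u \<bullet> x)" 0] by (simp add: mult_ac)
  then show ?thesis by (simp add: sep_def)
qed

text \<open>Moving from \<open>y\<close> towards \<open>p\<close> only raises the products with
  \<open>p\<close>, so no separating circle is gained. The circle \<open>b\<close> is reached at
  \<open>x\<close>, hence it separated \<open>y\<close> from \<open>p\<close> and is lost.\<close>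

lemma sep_strict_mono:
  assumes fin: "finite U" and b: "b \<in> U" "b \<bullet> x = 0" "b \<bullet> p \<noteq> 0"
    and x: "x = y + r *\<^sub>R p" "r > 0"
  shows "card (sep U p x) < card (sep U p y)"
proof (rule psubset_card_mono)
  have eq: "(u \<bullet> p) * (u \<bullet> y) = (u \<bullet> p) * (u \<bullet> x) - r * (u \<bullet> p)\<^sup>2" for u
    using x(1) by (simp add: inner_add_right algebra_simps power2_eq_square)
  have "r * (u \<bullet> p)\<^sup>2 \<ge> 0" for u using x(2) by simp
  then have "sep U p x \<subseteq> sep U p y"
    unfolding sep_def eq by (auto intro: order.strict_trans2 simp: less_diff_eq) 
  moreover have "r * (b \<bullet> p)\<^sup>2 > 0" using x(2) b(3) by simp
  then have "b \<in> sep U p y" "b \<notin> sep U p x" unfolding sep_def using b eq[of b] by simp_all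
  ultimately show "sep U p x \<subset> sep U p y" by blast
qed (use fin in \<open>simp add: sep_def\<close>)

text \<open>On the great circle a, seen from v, the number of separating circles strictly increases
  along either of the two half circles towards the antipode.\<close>

lemma card_vertices_on_circle:
  assumes gp: "general_position U" and v: "v \<in> opairs U"
  shows "card {w\<in>opairs U. ends v \<inter> ends w = {a} \<and> card (sep U (vpt v) (vpt w)) = j} \<le> 2"
    (is "card ?W \<le> 2")
proof (cases "a \<in> ends v")
  case False
  then have "?W = {}" by auto
  then show ?thesis by (simp only: card.empty)
next
  case True
  have fin: "finite U" using gp by (rule gp_finite)
  obtain b where ab: "ends v = {a, b}" "a \<noteq> b" "a \<in> U" "b \<in> U"
    using True v by (cases v) (auto simp: opairs_def ends_def)
  have W: "\<exists>b'. ends w = {a, b'} \<and> b' \<in> U \<and> b' \<notin> {a, b}" if "w \<in> ?W" for w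
  proof -
    have i: "{a, b} \<inter> ends w = {a}" and wo: "w \<in> opairs U" using that ab(1) by simp_all
    have "a \<in> ends w" using i by blast
    moreover have "fst w \<noteq> snd w" "fst w \<in> U" "snd w \<in> U" using wo by (auto simp: opairs_def)
    ultimately obtain b' where b': "ends w = {a, b'}" "b' \<in> U" "b' \<noteq> a"
      unfolding ends_def by (metis insert_commute insert_iff singletonD)
    moreover have "b' \<noteq> b" using i b' ab(2) by blast
    ultimately show ?thesis by blast
  qed
  have no: False
    if w: "w \<in> ?W" "z \<in> ?W"
      and r: "r > 0" "s > 0" "r *\<^sub>R vpt w = s *\<^sub>R vpt z + m *\<^sub>R vpt v" "m > 0" for w z r s m
  proof -
    obtain b' where b': "ends w = {a, b'}" "b' \<in> U" "b' \<notin> {a, b}" using W[OF w(1)] by blast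
    have "b' \<bullet> vpt w = 0" using b' ends_vpt[of b' w] by simp
    moreover have "b' \<bullet> vpt v \<noteq> 0" using vpt_zero_iff[OF gp v b'(2)] b' ab by simp
    ultimately have "card (sep U (vpt v) (r *\<^sub>R vpt w)) < card (sep U (vpt v) (s *\<^sub>R vpt z))"
      using sep_strict_mono[OF fin b'(2) _ _ r(3,4)] by simp
    then show False using w unfolding sep_scale[OF r(1)] sep_scale[OF r(2)] by simp
  qed
  have "inj_on (\<lambda>w. b \<bullet> vpt w > 0) ?W"
  proof (rule inj_onI)
    fix w z assume w: "w \<in> ?W" "z \<in> ?W" and eq: "(b \<bullet> vpt w > 0) = (b \<bullet> vpt z > 0)"
    have wo: "w \<in> opairs U" "z \<in> opairs U" using w by auto
    obtain b' where b': "ends w = {a, b'}" "b' \<in> U" "b' \<notin> {a, b}" using W[OF w(1)] by blast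
    obtain c' where c': "ends z = {a, c'}" "c' \<in> U" "c' \<notin> {a, b}" using W[OF w(2)] by blast
    have bn: "b \<notin> ends w" "b \<notin> ends z" using b'(1,3) c'(1,3) ab(2) by auto
    have nz: "b \<bullet> vpt w \<noteq> 0" "b \<bullet> vpt z \<noteq> 0"
      using vpt_zero_iff[OF gp wo(1) ab(4)] vpt_zero_iff[OF gp wo(2) ab(4)] bn
      by simp_all
    \<comment> \<open>The weights eliminate \<open>b\<close> from the difference \<open>D\<close>.
      As \<open>a\<close> vanishes on it too, \<open>D\<close> is a multiple of
      \<open>vpt v\<close>, and the sign of the factor decides which of the two vertices is closer
      to \<open>v\<close>.\<close>
    define r s where "r = \<bar>b \<bullet> vpt z\<bar>" and "s = \<bar>b \<bullet> vpt w\<bar>"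
    have rs: "r > 0" "s > 0" using nz by (auto simp: r_def s_def)
    define D where "D = r *\<^sub>R vpt w - s *\<^sub>R vpt z"
    have "b \<bullet> D = 0" using eq nz by (auto simp: D_def r_def s_def inner_diff_right abs_if)
    moreover have "a \<bullet> D = 0"
      using ends_vpt[of a w] ends_vpt[of a z] b' c' by (simp add: D_def inner_diff_right)
    ultimately obtain m0 where m0: "D = m0 *\<^sub>R (a \<times> b)"
      using parallel_cross gp_pair[OF gp ab(3,4,2)] by blast
    have "vpt v = a \<times> b \<or> vpt v = - (a \<times> b)"
      using ab(1,2) v cross_skew[of b a]
      by (cases v) (auto simp: ends_def vpt_def opairs_def doubleton_eq_iff)
    then obtain m where m: "D = m *\<^sub>R vpt v"
      using m0 by (metis scaleR_minus_left scaleR_minus_right minus_minus)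
    consider "m > 0" | "m < 0" | "m = 0" by linarith
    then show "w = z"
    proof cases
      case 1
      have "r *\<^sub>R vpt w = s *\<^sub>R vpt z + m *\<^sub>R vpt v" using m by (simp add: D_def algebra_simps)
      then show ?thesis using no[OF w rs _ 1] by blast
    next
      case 2
      have "s *\<^sub>R vpt z = r *\<^sub>R vpt w + (-m) *\<^sub>R vpt v" using m by (simp add: D_def algebra_simps)
      then show ?thesis using no[OF w(2,1) rs(2,1), of "-m"] 2 by simp
    next
      case 3
      then have eq': "r *\<^sub>R vpt w = s *\<^sub>R vpt z" using m by (simp add: D_def)
      have "c' \<bullet> (r *\<^sub>R vpt w) = 0" unfolding eq' using c' ends_vpt[of c' z] by simp
      then have "c' \<bullet> vpt w = 0" using rs by simp
      then have "c' = b'" using vpt_zero_iff[OF gp wo(1) c'(2)] b' c' by simp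
      then have "ends w = ends z" using b' c' by simp
      then consider "w = z" | "z = (snd w, fst w)" using wo
        by (cases w; cases z) (auto simp: ends_def opairs_def doubleton_eq_iff)
      then show ?thesis
      proof cases
        case 2
        then have "vpt z = - vpt w" using cross_skew[of "snd w" "fst w"] by (simp add: vpt_def)
        then have "b \<bullet> vpt z = - (b \<bullet> vpt w)" by simp
        then show ?thesis using eq nz by linarith
      qed
    qed
  qed
  then have "card ?W \<le> card (UNIV :: bool set)" by (intro card_inj_on_le) auto
  then show ?thesis by simp
qed

text \<open>This is the probability that a random sample contains \<open>A\<close> and misses
  \<open>B\<close>. The product of the sums \<open>f i + g i\<close> is expanded over subsets, with
  \<open>f\<close> zero on \<open>B\<close> and \<open>g\<close> zero on \<open>A\<close> to discard
  forbidden samples.\<close>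

lemma bernoulli_subset:
  fixes p :: real
  assumes fin: "finite U" and A: "A \<subseteq> U" and B: "B \<subseteq> U" "A \<inter> B = {}"
  shows "(\<Sum>R\<in>Pow U. p ^ card R * (1 - p) ^ card (U - R) * of_bool (A \<subseteq> R \<and> B \<inter> R = {}))
    = p ^ card A * (1 - p) ^ card B"
proof -
  define f where "f i = p * of_bool (i \<notin> B)" for i
  define g where "g i = (1 - p) * of_bool (i \<notin> A)" for i
  have finA: "finite A" "finite B" using fin A B finite_subset by blast+
  have "prod f R * prod g (U - R) = p ^ card R * (1 - p) ^ card (U - R) * of_bool (A \<subseteq> R \<and> B \<inter> R = {})"
    if R: "R \<in> Pow U" for R
  proof -
    have finR: "finite R" using R fin finite_subset by blast
    have "(\<Prod>i\<in>R. of_bool (i \<notin> B) :: real) = of_bool (B \<inter> R = {})"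
      using finR by (cases "B \<inter> R = {}") (auto simp: prod_zero_iff intro!: prod.neutral)
    moreover have "(\<Prod>i\<in>U - R. of_bool (i \<notin> A) :: real) = of_bool (A \<subseteq> R)"
      using fin A by (cases "A \<subseteq> R") (auto simp: prod_zero_iff intro!: prod.neutral)
    ultimately show ?thesis by (simp add: f_def g_def prod.distrib of_bool_conj)
  qed
  then have "(\<Sum>R\<in>Pow U. p ^ card R * (1 - p) ^ card (U - R) * of_bool (A \<subseteq> R \<and> B \<inter> R = {}))
      = (\<Sum>R\<in>Pow U. prod f R * prod g (U - R))" by simp
  also have "\<dots> = (\<Prod>i\<in>U. f i + g i)" by (rule prod_add[OF fin, symmetric])
  also have "\<dots> = (\<Prod>i\<in>U. (if i \<in> A then p else 1) * (if i \<in> B then 1 - p else 1))"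
    by (rule prod.cong) (use B(2) in \<open>auto simp: f_def g_def\<close>)
  also have "\<dots> = (\<Prod>i\<in>U. if i \<in> A then p else 1) * (\<Prod>i\<in>U. if i \<in> B then 1 - p else 1)"
    by (rule prod.distrib)
  also have "\<dots> = p ^ card A * (1 - p) ^ card B"
    using fin A B by (simp add: prod.If_cases Int_absorb1)
  finally show ?thesis .
qed

text \<open>Both sides, multiplied by \<open>p\<^sup>2\<close>, bound the expected number of visible
  pairs in a sample: a pair needs its four circles and none of the separating ones, while a single
  vertex survives with probability \<open>p\<^sup>2\<close>.\<close>

lemma sum_disjoint_vertices:
  fixes p :: real
  assumes gp: "general_position U" and p: "0 < p" "p \<le> 1"
  shows "p\<^sup>2 * (\<Sum>(v, w)\<in>disjoint_vertices U. (1 - p) ^ card (sep U (vpt v) (vpt w))) \<le> 8 * card (opairs U)"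
proof -
  have fin: "finite U" using gp by (rule gp_finite)
  define P where "P R = p ^ card R * (1 - p) ^ card (U - R)" for R
  have P: "P R \<ge> 0" for R using p by (simp add: P_def)
  have finD: "finite (disjoint_vertices U)"
    by (rule finite_subset[of _ "Sigma (opairs U) (\<lambda>_. opairs U)"])
      (use finite_opairs[OF fin] in \<open>auto simp: disjoint_vertices_def\<close>)
  have "p ^ 4 * (\<Sum>(v, w)\<in>disjoint_vertices U. (1 - p) ^ card (sep U (vpt v) (vpt w)))
      = (\<Sum>(v, w)\<in>disjoint_vertices U. \<Sum>R\<in>Pow U.
          P R * of_bool (ends v \<union> ends w \<subseteq> R \<and> sep U (vpt v) (vpt w) \<inter> R = {}))"
    unfolding sum_distrib_left
  proof (rule sum.cong[OF refl], clarify)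
    fix v1 v2 w1 w2 assume "((v1, v2), (w1, w2)) \<in> disjoint_vertices U"
    then obtain v w where vw: "v = (v1, v2)" "w = (w1, w2)" "v \<in> opairs U" "w \<in> opairs U" "ends v \<inter> ends w = {}"
      by (auto simp: disjoint_vertices_def)
    have "card (ends v \<union> ends w) = 4"
      using vw(5) ends_opairs(2)[OF vw(3)] ends_opairs(2)[OF vw(4)]
      by (subst card_Un_disjoint) (auto simp: ends_def)
    moreover have "(ends v \<union> ends w) \<inter> sep U (vpt v) (vpt w) = {}"
      using ends_vpt[of _ v] ends_vpt[of _ w] by (auto simp: sep_def)
    moreover have "ends v \<union> ends w \<subseteq> U" "sep U (vpt v) (vpt w) \<subseteq> U"
      using ends_opairs(1)[OF vw(3)] ends_opairs(1)[OF vw(4)] by (auto simp: sep_def)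
    ultimately show "p ^ 4 * (1 - p) ^ card (sep U (vpt (v1, v2)) (vpt (w1, w2)))
      = (\<Sum>R\<in>Pow U. P R * of_bool (ends (v1, v2) \<union> ends (w1, w2) \<subseteq> R \<and> sep U (vpt (v1, v2)) (vpt (w1, w2)) \<inter> R = {}))"
      using bernoulli_subset[OF fin, of "ends v \<union> ends w" "sep U (vpt v) (vpt w)" p]
      unfolding P_def vw(1,2) by simp
  qed
  also have "\<dots> = (\<Sum>x\<in>disjoint_vertices U. \<Sum>R\<in>Pow U.
      P R * of_bool (ends (fst x) \<union> ends (snd x) \<subseteq> R \<and> sep U (vpt (fst x)) (vpt (snd x)) \<inter> R = {}))"
    by (simp add: split_def)
  also have "\<dots> = (\<Sum>R\<in>Pow U. \<Sum>x\<in>disjoint_vertices U.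
      P R * of_bool (ends (fst x) \<union> ends (snd x) \<subseteq> R \<and> sep U (vpt (fst x)) (vpt (snd x)) \<inter> R = {}))"
    by (rule sum.swap)
  also have "\<dots> = (\<Sum>R\<in>Pow U. P R * card (visible_pairs R))"
  proof (rule sum.cong[OF refl])
    fix R assume R: "R \<in> Pow U"
    have eq: "visible_pairs R = {x\<in>disjoint_vertices U.
        ends (fst x) \<union> ends (snd x) \<subseteq> R \<and> sep U (vpt (fst x)) (vpt (snd x)) \<inter> R = {}}"
      using R by (fastforce simp: visible_pairs_def disjoint_vertices_def opairs_def ends_def sep_def)
    show "(\<Sum>x\<in>disjoint_vertices U. P R * of_bool (ends (fst x) \<union> ends (snd x) \<subseteq> R \<and>
        sep U (vpt (fst x)) (vpt (snd x)) \<inter> R = {})) = P R * card (visible_pairs R)"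
      unfolding eq sum_distrib_left[symmetric] using finD
      by (simp add: of_bool_def sum.If_cases Int_def)
  qed
  also have "\<dots> \<le> (\<Sum>R\<in>Pow U. P R * (8 * real (card (opairs R))))"
  proof (intro sum_mono mult_left_mono P)
    fix R assume "R \<in> Pow U"
    then have gpR: "general_position R" using gp gp_subset by auto
    show "real (card (visible_pairs R)) \<le> 8 * real (card (opairs R))"
      using card_visible_pairs[OF gpR] card_opairs[OF gp_finite[OF gpR]] by linarith
  qed
  also have "\<dots> = 8 * (\<Sum>R\<in>Pow U. P R * card (opairs R))"
    by (simp add: sum_distrib_left mult_ac)
  also have "(\<Sum>R\<in>Pow U. P R * card (opairs R))
      = (\<Sum>R\<in>Pow U. \<Sum>v\<in>opairs U. P R * of_bool (ends v \<subseteq> R \<and> {} \<inter> R = {}))"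
  proof (rule sum.cong[OF refl])
    fix R assume R: "R \<in> Pow U"
    have eq: "opairs R = {v\<in>opairs U. ends v \<subseteq> R}"
      using R by (auto simp: opairs_def ends_def)
    show "P R * card (opairs R) = (\<Sum>v\<in>opairs U. P R * of_bool (ends v \<subseteq> R \<and> {} \<inter> R = {}))"
      unfolding eq sum_distrib_left[symmetric] using finite_opairs[OF fin]
      by (simp add: of_bool_def sum.If_cases Int_def)
  qed
  also have "\<dots> = (\<Sum>v\<in>opairs U. \<Sum>R\<in>Pow U. P R * of_bool (ends v \<subseteq> R \<and> {} \<inter> R = {}))"
    by (rule sum.swap)
  also have "\<dots> = (\<Sum>v\<in>opairs U. p\<^sup>2)"
  proof (rule sum.cong[OF refl])
    fix v assume v: "v \<in> opairs U"
    show "(\<Sum>R\<in>Pow U. P R * of_bool (ends v \<subseteq> R \<and> {} \<inter> R = {})) = p\<^sup>2"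
      using bernoulli_subset[OF fin ends_opairs(1)[OF v], of "{}" p] ends_opairs(2)[OF v]
      by (simp add: P_def)
  qed
  finally have "p\<^sup>2 * (p\<^sup>2 * (\<Sum>(v, w)\<in>disjoint_vertices U. (1 - p) ^ card (sep U (vpt v) (vpt w))))
      \<le> p\<^sup>2 * (8 * card (opairs U))"
    by (simp add: mult_ac power2_eq_square power4_eq_xxxx)
  then show ?thesis by (rule mult_left_le_imp_le) (use p in simp)
qed

section \<open>Vertices and chambers at a given distance\<close>

text \<open>Circles through \<open>v\<close> are left out: a curve starting at \<open>v\<close> can
  leave them at once, and only its interior counts.\<close>

definition crossings :: "(real^3) set \<Rightarrow> (real^3) \<times> (real^3) \<Rightarrow> (real^3) set \<Rightarrow> (real^3) set" where
  "crossings U v A = {u\<in>U - ends v. (u \<in> A) \<noteq> (u \<bullet> vpt v > 0)}"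

definition level_pairs :: "(real^3) set \<Rightarrow> nat \<Rightarrow> (((real^3) \<times> (real^3)) \<times> (real^3) set) set" where
  "level_pairs U k = {(v, A). v \<in> opairs U \<and> A \<in> chambers U \<and> card (crossings U v A) = k}"

definition level_chambers where
  "level_chambers U k v w = {A\<in>chambers U. w \<in> corners U A \<and> card (crossings U v A) = k}"

lemma finite_level_pairs: "finite U \<Longrightarrow> finite (level_pairs U k)"
  by (rule finite_subset[of _ "Sigma (opairs U) (\<lambda>_. chambers U)"])
    (auto simp: level_pairs_def finite_opairs finite_chambers)

text \<open>A cell with corner \<open>w\<close> is determined by the set \<open>T\<close> of ends of
  \<open>w\<close> on which it is not recorded like \<open>v\<close>. Circles separating
  \<open>v\<close> from the cell are those separating \<open>v\<close> from \<open>w\<close> plus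
  the members of \<open>T\<close> that do not pass through \<open>v\<close>.\<close>

lemma card_level_chambers:
  assumes gp: "general_position U" and v: "v \<in> opairs U" and w: "w \<in> opairs U"
  shows "card (level_chambers U k v w)
    \<le> card {T. T \<subseteq> ends w \<and> card (sep U (vpt v) (vpt w)) + card (T - ends v) = k}"
proof -
  have fin: "finite U" using gp by (rule gp_finite)
  let ?h = "\<lambda>A. {u\<in>ends w. (u \<in> A) \<noteq> (u \<bullet> vpt v > 0)}"
  have "inj_on ?h (level_chambers U k v w)"
  proof (rule inj_onI)
    fix A B assume A: "A \<in> level_chambers U k v w" and B: "B \<in> level_chambers U k v w" and eq: "?h A = ?h B"
    have "u \<in> A \<longleftrightarrow> u \<in> B" if "u \<in> ends w" for u
      using eq that by blast
    moreover have "A - ends w = B - ends w" using A B by (simp add: level_chambers_def corners_def)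
    ultimately show "A = B" by blast
  qed
  moreover have "?h ` level_chambers U k v w
    \<subseteq> {T. T \<subseteq> ends w \<and> card (sep U (vpt v) (vpt w)) + card (T - ends v) = k}"
  proof (rule image_subsetI)
    fix A assume "A \<in> level_chambers U k v w"
    then have A: "A \<in> chambers U" "w \<in> corners U A" "card (crossings U v A) = k"
      by (auto simp: level_chambers_def)
    have "u \<in> crossings U v A \<longleftrightarrow> u \<in> sep U (vpt v) (vpt w) \<union> (?h A - ends v)" if u: "u \<in> U" for u
    proof (cases "u \<in> ends w")
      case True
      then have "u \<bullet> vpt w = 0" by (rule ends_vpt)
      then show ?thesis using True u by (auto simp: crossings_def sep_def)
    next
      case False
      then have "u \<in> A \<longleftrightarrow> u \<bullet> vpt w > 0" using corner_mem[OF A(2) u] by simp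
      then show ?thesis using False u vpt_zero_iff[OF gp v u] vpt_zero_iff[OF gp w u]
        by (auto simp: crossings_def sep_def mult_less_0_iff)
    qed
    moreover have "ends w \<subseteq> U" by (rule ends_opairs(1)[OF w])
    moreover have "crossings U v A \<subseteq> U" "sep U (vpt v) (vpt w) \<subseteq> U" by (auto simp: crossings_def sep_def)
    ultimately have "crossings U v A = sep U (vpt v) (vpt w) \<union> (?h A - ends v)" by blast
    moreover have "sep U (vpt v) (vpt w) \<inter> (?h A - ends v) = {}"
      using ends_vpt[of _ w] by (auto simp: sep_def)
    moreover have "finite (sep U (vpt v) (vpt w))" "finite (?h A - ends v)"
      using fin by (auto simp: sep_def ends_def)
    ultimately have "card (sep U (vpt v) (vpt w)) + card (?h A - ends v) = k"
      using A(3) card_Un_disjoint[of "sep U (vpt v) (vpt w)" "?h A - ends v"] by simp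
    then show "?h A \<in> {T. T \<subseteq> ends w \<and> card (sep U (vpt v) (vpt w)) + card (T - ends v) = k}"
      by blast
  qed
  moreover have "finite {T. T \<subseteq> ends w \<and> card (sep U (vpt v) (vpt w)) + card (T - ends v) = k}"
    by (rule finite_subset[of _ "Pow (ends w)"]) (auto simp: ends_def)
  ultimately show ?thesis by (rule card_inj_on_le)
qed

text \<open>The set \<open>T\<close> is a subset of prescribed size of a two-element set, and no
  binomial coefficient \<open>2 choose m\<close> exceeds 2.\<close>

lemma card_level_chambers_disjoint:
  assumes gp: "general_position U" and v: "v \<in> opairs U" and w: "w \<in> opairs U"
    and disj: "ends v \<inter> ends w = {}"
  shows "card (level_chambers U k v w) \<le> (if card (sep U (vpt v) (vpt w)) \<le> k then 2 else 0)"
proof -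
  let ?j = "card (sep U (vpt v) (vpt w))"
  have "{T. T \<subseteq> ends w \<and> ?j + card (T - ends v) = k} =
      (if ?j \<le> k then {T. T \<subseteq> ends w \<and> card T = k - ?j} else {})"
  proof -
    have "T - ends v = T" if "T \<subseteq> ends w" for T using that disj by blast
    then show ?thesis by auto
  qed
  moreover have "card {T. T \<subseteq> ends w \<and> card T = m} \<le> 2" for m
  proof -
    have "card {T. T \<subseteq> ends w \<and> card T = m} = 2 choose m"
      using n_subsets[of "ends w" m] ends_opairs(2)[OF w] by (simp add: ends_def)
    also have "\<dots> \<le> 2"
    proof -
      consider "m = 0" | "m = 1" | "m = 2" | "m > 2" by linarith
      then show ?thesis by cases (auto simp: binomial_eq_0)
    qed
    finally show ?thesis .
  qed
  ultimately show ?thesis using card_level_chambers[OF gp v w, of k] order_trans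
    by (auto split: if_splits)
qed

text \<open>Membership of the shared circle \<open>a\<close> in \<open>T\<close> costs nothing,
  membership of the other end costs one; hence two cells for each of the values \<open>k\<close> and
  \<open>k - 1\<close>.\<close>

lemma card_level_chambers_share:
  assumes gp: "general_position U" and v: "v \<in> opairs U" and w: "w \<in> opairs U"
    and share: "ends v \<inter> ends w = {a}"
  shows "card (level_chambers U k v w) \<le> 2 * of_bool (card (sep U (vpt v) (vpt w)) = k)
    + 2 * of_bool (card (sep U (vpt v) (vpt w)) + 1 = k)"
proof -
  let ?j = "card (sep U (vpt v) (vpt w))"
  have "a \<in> ends w" using share by blast
  then obtain b where b: "ends w = {a, b}" "b \<noteq> a"
    using w by (cases w) (auto simp: opairs_def ends_def)
  have "a \<in> ends v" "b \<notin> ends v" using share b by auto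
  then have sub: "{T. T \<subseteq> ends w \<and> ?j + card (T - ends v) = k}
    \<subseteq> (if ?j = k then {{}, {a}} else if ?j + 1 = k then {{b}, {a, b}} else {})"
  proof -
    have "Pow (ends w) = {{}, {a}, {b}, {a, b}}" unfolding b(1) by (auto simp: Pow_insert)
    then have T: "T = {} \<or> T = {a} \<or> T = {b} \<or> T = {a, b}" if "T \<subseteq> ends w" for T
      using that by blast
    have D: "{} - ends v = {}" "{a} - ends v = {}" "{b} - ends v = {b}" "{a, b} - ends v = {b}"
      using \<open>a \<in> ends v\<close> \<open>b \<notin> ends v\<close> by auto
    show ?thesis
    proof clarify
      fix T assume "T \<subseteq> ends w" "k = ?j + card (T - ends v)"
      with T[OF this(1)] D show "T \<in> (if ?j = ?j + card (T - ends v) then {{}, {a}}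
          else if ?j + 1 = ?j + card (T - ends v) then {{b}, {a, b}} else {})"
        by (elim disjE) simp_all
    qed
  qed
  have "card {T. T \<subseteq> ends w \<and> ?j + card (T - ends v) = k}
    \<le> card (if ?j = k then {{}, {a}} else if ?j + 1 = k then {{b}, {a, b}} else {})"
    by (rule card_mono[OF _ sub]) simp
  also have "\<dots> \<le> 2 * of_bool (?j = k) + 2 * of_bool (?j + 1 = k)"
    using b(2) by auto
  finally show ?thesis using card_level_chambers[OF gp v w, of k] by linarith
qed

text \<open>If \<open>w\<close> is \<open>v\<close> the distance is 0; if \<open>w\<close> is the
  antipode it is \<open>card U - 2\<close>. The hypotheses on \<open>k\<close> exclude both
  values.\<close>

lemma level_chambers_same:
  assumes gp: "general_position U" and v: "v \<in> opairs U" and w: "w \<in> opairs U"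
    and same: "ends v = ends w" and k: "0 < k" "k + 2 < card U"
  shows "level_chambers U k v w = {}"
proof -
  have fin: "finite U" using gp by (rule gp_finite)
  have "card (crossings U v A) \<noteq> k" if A: "w \<in> corners U A" for A
  proof -
    consider "w = v" | "w = (snd v, fst v)" using same v w
      by (cases v; cases w) (auto simp: ends_def opairs_def doubleton_eq_iff)
    then show ?thesis
    proof cases
      case 1
      then have "crossings U v A = {}" using corner_mem[OF A] by (auto simp: crossings_def)
      then show ?thesis using k by simp
    next
      case 2
      then have m: "vpt w = - vpt v" using cross_skew[of "snd v" "fst v"] by (simp add: vpt_def)
      have "(u \<in> A) \<noteq> (u \<bullet> vpt v > 0)" if u: "u \<in> U" "u \<notin> ends v" for u
      proof -
        have "u \<in> A \<longleftrightarrow> u \<bullet> vpt v < 0" using corner_mem[OF A u(1)] u same m by simp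
        moreover have "u \<bullet> vpt v \<noteq> 0" using vpt_zero_iff[OF gp v u(1)] u by simp
        ultimately show ?thesis by linarith
      qed
      then have "crossings U v A = U - ends v" unfolding crossings_def by blast
      then have "card (crossings U v A) = card U - 2"
        using ends_opairs[OF v] fin by (simp add: card_Diff_subset finite_subset)
      then show ?thesis using k by linarith
    qed
  qed
  then show ?thesis by (auto simp: level_chambers_def)
qed

text \<open>Each cell is listed once for every corner, and it has at least three.\<close>

lemma triple_level_pairs:
  assumes gp: "general_position U" and three: "card U \<ge> 3"
  shows "3 * card (level_pairs U k) \<le> (\<Sum>v\<in>opairs U. \<Sum>w\<in>opairs U. card (level_chambers U k v w))"
proof -
  have fin: "finite U" using gp by (rule gp_finite)
  have two: "card U \<ge> 2" using three by simp
  have finC: "finite (corners U A)" for A by (rule finite_corners[OF fin])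
  have finL: "finite (level_chambers U k v w)" for v w
    by (rule finite_subset[OF _ finite_chambers[OF fin]]) (auto simp: level_chambers_def)
  have "3 * card (level_pairs U k) = (\<Sum>x\<in>level_pairs U k. 3)" by simp
  also have "\<dots> \<le> (\<Sum>x\<in>level_pairs U k. card (corners U (snd x)))"
  proof (rule sum_mono)
    fix x assume "x \<in> level_pairs U k"
    then have A: "snd x \<in> chambers U" by (auto simp: level_pairs_def)
    show "3 \<le> card (corners U (snd x))"
      using three_edges[OF gp A three] card_corners_edges[OF gp A two] by simp
  qed
  also have "\<dots> = card (Sigma (level_pairs U k) (\<lambda>x. corners U (snd x)))"
    using finite_level_pairs[OF fin] finC by (simp add: card_SigmaI)
  also have "\<dots> = card (Sigma (opairs U) (\<lambda>v. Sigma (opairs U) (level_chambers U k v)))"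
    by (rule bij_betw_same_card[of "\<lambda>((v, A), w). (v, (w, A))"],
        rule bij_betwI[of _ _ _ "\<lambda>(v, (w, A)). ((v, A), w)"])
      (auto simp: level_pairs_def level_chambers_def corners_def)
  also have "\<dots> = (\<Sum>v\<in>opairs U. \<Sum>w\<in>opairs U. card (level_chambers U k v w))"
    using finite_opairs[OF fin] finL by (simp add: card_SigmaI)
  finally show ?thesis .
qed

lemma sum_level_chambers:
  fixes t :: real
  assumes gp: "general_position U" and k: "0 < k" "k + 2 < card U" and t: "0 < t" "t \<le> 1"
  shows "t ^ k * (\<Sum>v\<in>opairs U. \<Sum>w\<in>opairs U. card (level_chambers U k v w))
    \<le> 2 * (\<Sum>(v, w)\<in>disjoint_vertices U. t ^ card (sep U (vpt v) (vpt w)))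
      + 16 * t ^ k * card (opairs U)"
proof -
  have fin: "finite U" using gp by (rule gp_finite)
  have finO: "finite (opairs U)" by (rule finite_opairs[OF fin])
  define j where "j v w = card (sep U (vpt v) (vpt w))" for v w
  \<comment> \<open>\<open>D\<close> bounds pairs without a common circle, using that
    \<open>t ^ k\<close> is at most \<open>t ^ j\<close> for \<open>j \<le> k\<close>;
    \<open>E\<close> bounds those with exactly one, for which no sampling weight is needed.\<close>
  define D where "D v w = 2 * (of_bool (ends v \<inter> ends w = {}) * t ^ j v w)" for v w
  define E where "E v w = (\<Sum>a\<in>ends v. 2 * of_bool (ends v \<inter> ends w = {a} \<and> j v w = k)
    + 2 * of_bool (ends v \<inter> ends w = {a} \<and> j v w = k - 1) :: real)" for v w
  have E0: "E v w \<ge> 0" for v w unfolding E_def by (intro sum_nonneg) simp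
  have pt: "t ^ k * card (level_chambers U k v w) \<le> D v w + t ^ k * E v w"
    if v: "v \<in> opairs U" and w: "w \<in> opairs U" for v w
  proof -
    obtain a b where ab: "ends v = {a, b}" using v by (cases v) (auto simp: ends_def)
    consider "ends v \<inter> ends w = {}" | "ends v = ends w"
      | a where "a \<in> ends v" "ends v \<inter> ends w = {a}"
    proof -
      have "ends v = ends w" if "ends v \<subseteq> ends w"
        using card_subset_eq[OF _ that] ends_opairs(2)[OF v] ends_opairs(2)[OF w] by (simp add: ends_def)
      then show ?thesis using that ab by (cases "a \<in> ends w"; cases "b \<in> ends w"; cases "a = b") auto
    qed
    then show ?thesis
    proof cases
      case 1
      have "t ^ k * card (level_chambers U k v w) \<le> D v w"
      proof (cases "j v w \<le> k")
        case True
        have "t ^ k * card (level_chambers U k v w) \<le> t ^ k * 2"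
          using card_level_chambers_disjoint[OF gp v w 1, of k] True t
          by (intro mult_left_mono) (auto simp: j_def)
        also have "\<dots> \<le> t ^ j v w * 2"
          using power_decreasing[OF True, of t] t by simp
        finally show ?thesis using 1 by (simp add: D_def)
      next
        case False
        then show ?thesis using card_level_chambers_disjoint[OF gp v w 1, of k] t
          by (simp add: j_def D_def)
      qed
      then show ?thesis using E0[of v w] t by (simp add: add_increasing2)
    next
      case 2
      then show ?thesis using level_chambers_same[OF gp v w 2 k] E0[of v w] t by (simp add: D_def)
    next
      case (3 a)
      have "real (card (level_chambers U k v w)) \<le> 2 * of_bool (j v w = k) + 2 * of_bool (j v w = k - 1)"
      proof -
        have "j v w + 1 = k \<longleftrightarrow> j v w = k - 1" using k(1) by auto
        then have "card (level_chambers U k v w) \<le> 2 * of_bool (j v w = k) + 2 * of_bool (j v w = k - 1)"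
          using card_level_chambers_share[OF gp v w 3(2), of k] by (simp add: j_def)
        then have "real (card (level_chambers U k v w)) \<le> real (2 * of_bool (j v w = k) + 2 * of_bool (j v w = k - 1))"
          by (rule of_nat_mono)
        then show ?thesis by simp
      qed
      also have "\<dots> = 2 * of_bool (ends v \<inter> ends w = {a} \<and> j v w = k)
          + 2 * of_bool (ends v \<inter> ends w = {a} \<and> j v w = k - 1)"
        using 3(2) by simp
      also have "\<dots> \<le> E v w"
        unfolding E_def by (rule member_le_sum[OF 3(1)]) (simp_all add: ends_def)
      finally have "t ^ k * card (level_chambers U k v w) \<le> t ^ k * E v w"
        using t by (intro mult_left_mono) auto
      then show ?thesis using 3(2) by (simp add: D_def)
    qed
  qed
  have "t ^ k * (\<Sum>v\<in>opairs U. \<Sum>w\<in>opairs U. card (level_chambers U k v w))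
      = (\<Sum>v\<in>opairs U. \<Sum>w\<in>opairs U. t ^ k * card (level_chambers U k v w))"
    by (simp add: sum_distrib_left)
  also have "\<dots> \<le> (\<Sum>v\<in>opairs U. \<Sum>w\<in>opairs U. D v w + t ^ k * E v w)"
    by (intro sum_mono pt)
  also have "\<dots> = (\<Sum>v\<in>opairs U. \<Sum>w\<in>opairs U. D v w) + t ^ k * (\<Sum>v\<in>opairs U. \<Sum>w\<in>opairs U. E v w)"
    by (simp add: sum.distrib sum_distrib_left)
  also have "(\<Sum>v\<in>opairs U. \<Sum>w\<in>opairs U. D v w)
      = 2 * (\<Sum>(v, w)\<in>disjoint_vertices U. t ^ card (sep U (vpt v) (vpt w)))"
  proof -
    have "(\<Sum>v\<in>opairs U. \<Sum>w\<in>opairs U. D v w)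
        = (\<Sum>x\<in>Sigma (opairs U) (\<lambda>_. opairs U). D (fst x) (snd x))"
      using finO by (simp add: sum.Sigma split_def)
    also have "\<dots> = 2 * (\<Sum>x\<in>Sigma (opairs U) (\<lambda>_. opairs U). of_bool (ends (fst x) \<inter> ends (snd x) = {}) * t ^ j (fst x) (snd x))"
      unfolding D_def by (rule sum_distrib_left[symmetric])
    also have "(\<Sum>x\<in>Sigma (opairs U) (\<lambda>_. opairs U). of_bool (ends (fst x) \<inter> ends (snd x) = {}) * t ^ j (fst x) (snd x))
        = (\<Sum>x\<in>disjoint_vertices U. t ^ j (fst x) (snd x))"
      by (rule sum.mono_neutral_cong_right)
        (use finO in \<open>auto simp: disjoint_vertices_def\<close>)
    finally show ?thesis by (simp add: split_def j_def)
  qed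
  also have "(\<Sum>v\<in>opairs U. \<Sum>w\<in>opairs U. E v w) \<le> (\<Sum>v\<in>opairs U. 16)"
  proof (rule sum_mono)
    fix v assume v: "v \<in> opairs U"
    have c: "(\<Sum>w\<in>opairs U. of_bool (ends v \<inter> ends w = {a} \<and> j v w = i)) \<le> (2::real)" for a i
    proof -
      have "(\<Sum>w\<in>opairs U. of_bool (ends v \<inter> ends w = {a} \<and> j v w = i))
          = real (card {w\<in>opairs U. ends v \<inter> ends w = {a} \<and> card (sep U (vpt v) (vpt w)) = i})"
        using finO by (simp add: of_bool_def sum.If_cases Int_def j_def)
      then show ?thesis using card_vertices_on_circle[OF gp v, of a i] by simp
    qed
    have "(\<Sum>w\<in>opairs U. E v w) = (\<Sum>a\<in>ends v.
        2 * (\<Sum>w\<in>opairs U. of_bool (ends v \<inter> ends w = {a} \<and> j v w = k))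
        + 2 * (\<Sum>w\<in>opairs U. of_bool (ends v \<inter> ends w = {a} \<and> j v w = k - 1)))"
      unfolding E_def by (subst sum.swap) (simp add: sum.distrib sum_distrib_left)
    also have "\<dots> \<le> (\<Sum>a\<in>ends v. 2 * 2 + 2 * 2)"
      by (intro sum_mono add_mono mult_left_mono c) auto
    also have "\<dots> = 16" using ends_opairs(2)[OF v] by simp
    finally show "(\<Sum>w\<in>opairs U. E v w) \<le> 16" .
  qed
  finally show ?thesis using t by (simp add: mult_ac)
qed

section \<open>Choice of the probability and the final average\<close>

lemma exp_power_bound:
  assumes "0 < (k::nat)"
  shows "(real k / (real k + 2)) ^ k * exp 2 \<ge> 1"
proof -
  \<comment> \<open>The base \<open>k / (k + 2)\<close> is the reciprocal of
    \<open>1 + 2 / k\<close>, whose \<open>k\<close>-th power stays below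
    \<open>exp 2\<close>.\<close>
  have "1 + 2 / real k \<le> exp (2 / real k)" by (rule exp_ge_add_one_self)
  then have "(1 + 2 / real k) ^ k \<le> exp (2 / real k) ^ k" by (intro power_mono) auto
  also have "\<dots> = exp 2" using assms by (simp flip: exp_of_nat_mult)
  finally have e: "(1 + 2 / real k) ^ k \<le> exp 2" .
  have "1 + 2 / real k = (real k + 2) / real k" using assms by (simp add: field_simps)
  then have eq: "(real k / (real k + 2)) * (1 + 2 / real k) = 1" using assms by simp
  have "1 = ((real k / (real k + 2)) * (1 + 2 / real k)) ^ k" unfolding eq by simp
  also have "\<dots> = (real k / (real k + 2)) ^ k * (1 + 2 / real k) ^ k"
    by (rule power_mult_distrib)
  also have "\<dots> \<le> (real k / (real k + 2)) ^ k * exp 2"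
    by (intro mult_left_mono e) auto
  finally show ?thesis .
qed

lemma level_pairs_bound:
  assumes gp: "general_position U" and k: "0 < k" "k + 2 < card U"
  shows "3 * real (card (level_pairs U k)) \<le> (4 * (exp 1)\<^sup>2 * (real k + 2)\<^sup>2 + 16) * card (opairs U)"
proof -
  define p where "p = 2 / (real k + 2)"
  define t where "t = real k / (real k + 2)"
  have p: "0 < p" "p \<le> 1" and t: "0 < t" "t \<le> 1" and pt: "1 - p = t"
    using k by (auto simp: p_def t_def field_simps)
  define S where "S = (\<Sum>(v, w)\<in>disjoint_vertices U. t ^ card (sep U (vpt v) (vpt w)))"
  define N where "N = real (card (opairs U))"
  define X where "X = 3 * real (card (level_pairs U k))"
  have N: "N \<ge> 0" by (simp add: N_def)
  have "p\<^sup>2 * S \<le> 8 * N"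
    using sum_disjoint_vertices[OF gp p] by (simp add: pt S_def N_def)
  then have "(real k + 2)\<^sup>2 * (p\<^sup>2 * S) \<le> (real k + 2)\<^sup>2 * (8 * N)"
    by (intro mult_left_mono) auto
  then have "((real k + 2)\<^sup>2 * p\<^sup>2) * S \<le> 8 * ((real k + 2)\<^sup>2 * N)" by (simp only: mult_ac)
  moreover have "(real k + 2)\<^sup>2 * p\<^sup>2 = 4" by (simp add: p_def power_divide)
  ultimately have "4 * S \<le> 8 * ((real k + 2)\<^sup>2 * N)" by simp
  then have S: "S \<le> 2 * (real k + 2)\<^sup>2 * N" by linarith
  have "X \<le> real (\<Sum>v\<in>opairs U. \<Sum>w\<in>opairs U. card (level_chambers U k v w))"
    using triple_level_pairs[OF gp, of k] k unfolding X_def by linarith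
  then have "t ^ k * X \<le> t ^ k * real (\<Sum>v\<in>opairs U. \<Sum>w\<in>opairs U. card (level_chambers U k v w))"
    using t by (intro mult_left_mono) auto
  also have "\<dots> \<le> 2 * S + 16 * t ^ k * N"
    using sum_level_chambers[OF gp k t] by (simp add: S_def N_def)
  also have "\<dots> \<le> 4 * (real k + 2)\<^sup>2 * N + 16 * t ^ k * N" using S by linarith
  also have "\<dots> \<le> (4 * (real k + 2)\<^sup>2 * N) * (t ^ k * exp 2) + 16 * t ^ k * N"
    using mult_left_mono[OF exp_power_bound[OF k(1)], of "4 * (real k + 2)\<^sup>2 * N"] N
    by (simp add: t_def)
  also have "\<dots> = t ^ k * ((4 * exp 2 * (real k + 2)\<^sup>2 + 16) * N)" by (simp add: algebra_simps)
  finally have "X \<le> (4 * exp 2 * (real k + 2)\<^sup>2 + 16) * N"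
    by (rule mult_left_le_imp_le) (use t in simp)
  moreover have "exp 2 = (exp (1::real))\<^sup>2" by (simp flip: exp_of_nat_mult exp_double)
  ultimately show ?thesis by (simp add: X_def N_def)
qed

text \<open>Distance 0 means that the vertex is a corner of the cell, and four cells meet at a
  vertex.\<close>

lemma level_pairs_zero:
  assumes gp: "general_position U"
  shows "card (level_pairs U 0) \<le> 4 * card (opairs U)"
proof -
  have fin: "finite U" using gp by (rule gp_finite)
  have "level_pairs U 0 \<subseteq> Sigma (opairs U) (\<lambda>v. {A\<in>chambers U. v \<in> corners U A})"
  proof
    fix x assume "x \<in> level_pairs U 0"
    then obtain v A where x: "x = (v, A)" and v: "v \<in> opairs U" and A: "A \<in> chambers U"
      and "card (crossings U v A) = 0"
      by (auto simp: level_pairs_def)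
    then have "crossings U v A = {}" using fin by (simp add: crossings_def)
    then have "u \<in> A \<longleftrightarrow> u \<bullet> vpt v > 0" if "u \<in> U" "u \<notin> ends v" for u
      using that by (auto simp: crossings_def)
    then have "A - ends v = positive U (vpt v)"
      using chambers_subset[OF A] ends_vpt[of _ v] by (force simp: positive_def)
    then show "x \<in> Sigma (opairs U) (\<lambda>v. {A\<in>chambers U. v \<in> corners U A})"
      using v A by (simp add: x corners_def)
  qed
  then have "card (level_pairs U 0) \<le> card (Sigma (opairs U) (\<lambda>v. {A\<in>chambers U. v \<in> corners U A}))"
    by (intro card_mono) (use finite_opairs[OF fin] finite_chambers[OF fin] in auto)
  also have "\<dots> = 4 * card (opairs U)"
    using finite_opairs[OF fin] finite_chambers[OF fin] by (simp add: card_SigmaI card_chambers_at_vertex[OF gp])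
  finally show ?thesis .
qed

lemma level_pairs_average:
  assumes gp: "general_position U" and k: "3 * k < card U"
  shows "real (card (level_pairs U k)) \<le> 4 * exp 1 * (real k + 2)\<^sup>2 * card (chambers U)"
proof -
  define e :: real where "e = exp 1"
  have e: "2 \<le> e" "e < 272/100" using exp_ge_add_one_self[of 1] e_less_272 by (simp_all add: e_def)
  have "card (opairs U) \<le> card (chambers U)"
    using card_chambers_ge[OF gp] card_opairs[OF gp_finite[OF gp]] by simp
  then have N: "real (card (opairs U)) \<le> real (card (chambers U))" by simp
  have main: "real (card (level_pairs U k)) \<le> 4 * e * (real k + 2)\<^sup>2 * card (opairs U)"
  proof (cases "k = 0")
    case True
    have "real (card (level_pairs U 0)) \<le> 4 * real (card (opairs U))"
      using level_pairs_zero[OF gp] by linarith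
    also have "\<dots> \<le> (4 * e * (real 0 + 2)\<^sup>2) * card (opairs U)"
      using e by (intro mult_right_mono) auto
    finally show ?thesis using True by simp
  next
    case False
    define y where "y = (real k + 2)\<^sup>2"
    have "(3::real)\<^sup>2 \<le> y" unfolding y_def using False by (intro power_mono) auto
    then have y: "9 \<le> y" by simp
    \<comment> \<open>The goal \<open>4 * e\<^sup>2 * y + 16 \<le> 12 * e * y\<close> amounts to
      \<open>4 \<le> e * (3 - e) * y\<close>, and the estimates give 0.56 * 9 = 5.04.\<close>
    have "2 * (28/100) \<le> e * (3 - e)" using e by (intro mult_mono) auto
    then have "(2 * (28/100)) * 9 \<le> (e * (3 - e)) * y" using y e by (intro mult_mono) auto
    then have "4 * e\<^sup>2 * y + 16 \<le> 12 * e * y" by (simp add: algebra_simps power2_eq_square)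
    then have "(4 * e\<^sup>2 * y + 16) * card (opairs U) \<le> (12 * e * y) * card (opairs U)"
      by (intro mult_right_mono) auto
    \<comment> \<open>From \<open>k \<ge> 1\<close> and \<open>3 * k < card U\<close> follows
      \<open>k + 2 < card U\<close>.\<close>
    then show ?thesis using level_pairs_bound[OF gp, of k] False k by (simp add: e_def y_def)
  qed
  also have "\<dots> \<le> 4 * e * (real k + 2)\<^sup>2 * card (chambers U)"
    using N e by (intro mult_left_mono) auto
  finally show ?thesis by (simp add: e_def)
qed

section \<open>Arrangements of great circles\<close>

lemma great_circle_scale: "m \<noteq> 0 \<Longrightarrow> great_circle (m *\<^sub>R u) = great_circle u"
  by (simp add: great_circle_def)

lemma simple_arrangement_normals:
  assumes "simple_arrangement C"
  obtains U where "general_position U" "bij_betw great_circle U C"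
proof -
  have fin: "finite C" and gc: "\<And>c. c \<in> C \<Longrightarrow> \<exists>u. u \<noteq> 0 \<and> c = great_circle u"
    and simple: "\<And>a b c. a \<in> C \<Longrightarrow> b \<in> C \<Longrightarrow> c \<in> C \<Longrightarrow> a \<noteq> b \<Longrightarrow> a \<noteq> c \<Longrightarrow> b \<noteq> c \<Longrightarrow> a \<inter> b \<inter> c = {}"
    using assms by (auto simp: simple_arrangement_def arrangement_def is_great_circle_def)
  obtain N where N: "\<And>c. c \<in> C \<Longrightarrow> N c \<noteq> 0" "\<And>c. c \<in> C \<Longrightarrow> great_circle (N c) = c"
    using gc by metis
  define U where "U = N ` C"
  have bij: "bij_betw great_circle U C"
    by (rule bij_betw_byWitness[of _ N]) (use N in \<open>auto simp: U_def\<close>)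
  then have inj: "inj_on great_circle U" by (simp add: bij_betw_def)
  have pair: "a \<times> b \<noteq> 0" if ab: "a \<in> U" "b \<in> U" "a \<noteq> b" for a b
  proof
    assume "a \<times> b = 0"
    then have "(a \<bullet> b) *\<^sub>R a = (a \<bullet> a) *\<^sub>R b" using Lagrange[of a a b] by simp
    moreover have nz: "a \<noteq> 0" "b \<noteq> 0" using ab N(1) by (auto simp: U_def)
    ultimately have "inverse (a \<bullet> a) *\<^sub>R ((a \<bullet> b) *\<^sub>R a) = b" by simp
    then have b: "b = (inverse (a \<bullet> a) * (a \<bullet> b)) *\<^sub>R a" by simp
    moreover have "inverse (a \<bullet> a) * (a \<bullet> b) \<noteq> 0" using b nz by (metis scaleR_zero_left)
    ultimately have "great_circle b = great_circle a" by (metis great_circle_scale)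
    then show False using inj ab by (auto dest: inj_onD)
  qed
  have triple: "c \<bullet> (a \<times> b) \<noteq> 0" if abc: "a \<in> U" "b \<in> U" "c \<in> U" "a \<noteq> b" "a \<noteq> c" "b \<noteq> c" for a b c
  proof
    assume c: "c \<bullet> (a \<times> b) = 0"
    \<comment> \<open>If the three normals were dependent, the unit vector along
      \<open>a \<times> b\<close> would be a common point of three distinct circles.\<close>
    define p where "p = (1 / norm (a \<times> b)) *\<^sub>R (a \<times> b)"
    have "norm p = 1" using pair abc by (simp add: p_def)
    then have "p \<in> great_circle a \<inter> great_circle b \<inter> great_circle c"
      using c by (simp add: great_circle_def S2_def p_def dot_cross_self)
    moreover have "great_circle a \<in> C" "great_circle b \<in> C" "great_circle c \<in> C"
      using bij abc by (auto simp: bij_betw_def)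
    moreover have "great_circle a \<noteq> great_circle b" "great_circle a \<noteq> great_circle c"
      "great_circle b \<noteq> great_circle c"
      using inj abc by (auto dest: inj_onD)
    ultimately show False using simple by blast
  qed
  have "0 \<notin> U" using N(1) by (auto simp: U_def)
  then have "general_position U"
    using fin pair triple by (simp add: general_position_def U_def)
  then show ?thesis using that bij by blast
qed

definition region :: "(real^3) set \<Rightarrow> (real^3) set \<Rightarrow> (real^3) set" where
  "region U A = {x\<in>S2. (\<forall>u\<in>U. u \<bullet> x \<noteq> 0) \<and> positive U x = A}"

lemma region_nonempty:
  assumes A: "A \<in> chambers U" and ne: "U \<noteq> {}"
  shows "region U A \<noteq> {}"
proof -
  obtain x where x: "\<And>u. u \<in> U \<Longrightarrow> u \<bullet> x \<noteq> 0" "A = positive U x"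
    using A chambersE by blast
  then have "x \<noteq> 0" using ne by force
  then have "(1 / norm x) *\<^sub>R x \<in> region U A"
    using x by (auto simp: region_def S2_def positive_def zero_less_divide_iff)
  then show ?thesis by blast
qed

text \<open>The region is the radial projection of an open convex cone, which avoids 0 because at
  least one normal is present.\<close>

lemma connected_region:
  assumes A: "A \<subseteq> U" and ne: "U \<noteq> {}"
  shows "connected (region U A)"
proof -
  define K where "K = (\<Inter>u\<in>A. {x. u \<bullet> x > 0}) \<inter> (\<Inter>u\<in>U - A. {x. u \<bullet> x < 0})"
  have "convex K" unfolding K_def
    by (intro convex_Int convex_INT convex_halfspace_gt convex_halfspace_lt)
  have K: "x \<in> K \<longleftrightarrow> (\<forall>u\<in>U. u \<bullet> x \<noteq> 0) \<and> positive U x = A" for x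
  proof
    assume "x \<in> K"
    then have *: "u \<bullet> x > 0" if "u \<in> A" for u using that by (auto simp: K_def)
    from \<open>x \<in> K\<close> have **: "u \<bullet> x < 0" if "u \<in> U - A" for u using that by (auto simp: K_def)
    show "(\<forall>u\<in>U. u \<bullet> x \<noteq> 0) \<and> positive U x = A"
      using * ** A by (force simp: positive_def)
  next
    assume "(\<forall>u\<in>U. u \<bullet> x \<noteq> 0) \<and> positive U x = A"
    then show "x \<in> K" by (force simp: K_def positive_def)
  qed
  have "0 \<notin> K" using K ne by auto
  have "region U A = (\<lambda>x. (1 / norm x) *\<^sub>R x) ` K"
  proof
    show "region U A \<subseteq> (\<lambda>x. (1 / norm x) *\<^sub>R x) ` K"
    proof
      fix x assume "x \<in> region U A"
      then have "x \<in> K" "norm x = 1" using K by (auto simp: region_def S2_def)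
      then have "x \<in> K" "x = (1 / norm x) *\<^sub>R x" by simp_all
      then show "x \<in> (\<lambda>x. (1 / norm x) *\<^sub>R x) ` K" by (rule rev_image_eqI)
    qed
    show "(\<lambda>x. (1 / norm x) *\<^sub>R x) ` K \<subseteq> region U A"
    proof (rule image_subsetI)
      fix x assume x: "x \<in> K"
      then have "x \<noteq> 0" using \<open>0 \<notin> K\<close> by auto
      then show "(1 / norm x) *\<^sub>R x \<in> region U A"
        using x K[of x] by (auto simp: region_def S2_def positive_def zero_less_divide_iff)
    qed
  qed
  moreover have "continuous_on K (\<lambda>x. (1 / norm x) *\<^sub>R x)"
    using \<open>0 \<notin> K\<close> by (intro continuous_intros) auto
  then have "connected ((\<lambda>x. (1 / norm x) *\<^sub>R x) ` K)"
    using convex_connected[OF \<open>convex K\<close>] by (rule connected_continuous_image)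
  ultimately show ?thesis by simp
qed

lemma connected_same_chamber:
  assumes T: "connected T" "\<And>u x. u \<in> U \<Longrightarrow> x \<in> T \<Longrightarrow> u \<bullet> x \<noteq> 0" and xy: "x \<in> T" "y \<in> T"
  shows "positive U x = positive U y"
proof -
  have "u \<bullet> y > 0" if u: "u \<in> U" and xy: "x \<in> T" "y \<in> T" "u \<bullet> x > 0" for u x y
  proof (rule ccontr)
    assume "\<not> u \<bullet> y > 0"
    then have "\<exists>z\<in>T. u \<bullet> z = 0"
      using connected_ivt_hyperplane[OF T(1) xy(2,1), of u 0] xy(3) by auto
    then show False using T(2)[OF u] by blast
  qed
  then show ?thesis using xy by (auto simp: positive_def)
qed

lemma cells_regions:
  assumes bij: "bij_betw great_circle U C" and ne: "U \<noteq> {}"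
  shows "cells C = region U ` chambers U" and "inj_on (region U) (chambers U)"
proof -
  let ?G = "S2 - \<Union>C"
  have G: "?G = {x\<in>S2. \<forall>u\<in>U. u \<bullet> x \<noteq> 0}"
    using bij by (auto simp: bij_betw_def great_circle_def)
  have comp: "region U A \<in> components ?G" if A: "A \<in> chambers U" for A
    unfolding in_components_maximal
  proof (intro conjI allI impI)
    show "region U A \<noteq> {}" by (rule region_nonempty[OF A ne])
    show "region U A \<subseteq> ?G" unfolding G by (auto simp: region_def)
    show "connected (region U A)" by (rule connected_region[OF chambers_subset[OF A] ne])
    fix T assume T: "T \<noteq> {} \<and> region U A \<subseteq> T \<and> T \<subseteq> ?G \<and> connected T"
    obtain x where x: "x \<in> region U A" using region_nonempty[OF A ne] by blast
    have "T \<subseteq> region U A"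
    proof
      fix y assume y: "y \<in> T"
      have TG: "x \<in> S2 \<and> (\<forall>u\<in>U. u \<bullet> x \<noteq> 0)" if "x \<in> T" for x using T that G by blast
      have "positive U y = positive U x"
        by (rule connected_same_chamber[of T]) (use T TG x y in auto)
      then show "y \<in> region U A" using x TG[OF y] by (simp add: region_def)
    qed
    then show "T = region U A" using T by blast
  qed
  show "cells C = region U ` chambers U"
  proof
    show "region U ` chambers U \<subseteq> cells C" using comp by (auto simp: cells_def)
    show "cells C \<subseteq> region U ` chambers U"
    proof
      fix F assume "F \<in> cells C"
      then have F: "F \<in> components ?G" by (simp add: cells_def)
      then obtain x where x: "x \<in> F" using in_components_nonempty by blast
      then have xG: "x \<in> S2" "\<forall>u\<in>U. u \<bullet> x \<noteq> 0" using in_components_subset[OF F] G by auto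
      then have A: "positive U x \<in> chambers U" and "x \<in> region U (positive U x)"
        by (auto simp: chambers_def region_def)
      then have "F = region U (positive U x)"
        using components_nonoverlap[OF F comp[OF A]] x by blast
      then show "F \<in> region U ` chambers U" using A by blast
    qed
  qed
  show "inj_on (region U) (chambers U)"
  proof (rule inj_onI)
    fix A B assume "A \<in> chambers U" "region U A = region U B"
    then show "A = B" using region_nonempty[OF _ ne, of A] by (auto simp: region_def)
  qed
qed

lemma crossings_opposite:
  assumes gp: "general_position U" and pr: "pr \<in> opairs U" and u: "u \<in> U"
    and y: "u \<bullet> y \<noteq> 0" "positive U y = A"
  shows "u \<in> crossings U pr A \<longleftrightarrow> (u \<bullet> vpt pr) * (u \<bullet> y) < 0"
proof -
  have "u \<in> A \<longleftrightarrow> u \<bullet> y > 0" using y(2) u by (auto simp: positive_def)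
  then show ?thesis
    using vpt_zero_iff[OF gp pr u] y(1) u by (auto simp: crossings_def mult_less_0_iff)
qed

text \<open>Every curve must cross the separating circles by the intermediate value theorem, and the
  projected segment from \<open>v\<close> to a point of the cell crosses no others.\<close>

lemma arr_dist_crossings:
  assumes gp: "general_position U" and bij: "bij_betw great_circle U C"
    and pr: "pr \<in> opairs U" and v: "v = (1 / norm (vpt pr)) *\<^sub>R vpt pr" and A: "A \<in> chambers U"
  shows "arr_dist C {v} (region U A) = card (crossings U pr A)"
proof -
  have fin: "finite U" using gp by (rule gp_finite)
  have ne: "U \<noteq> {}" using pr by (auto simp: opairs_def)
  have inj: "inj_on great_circle U" and C: "C = great_circle ` U" using bij by (auto simp: bij_betw_def)
  define r where "r = 1 / norm (vpt pr)"
  have r: "r > 0" "v = r *\<^sub>R vpt pr" using vpt_nonzero[OF gp pr] v by (simp_all add: r_def)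
  have cr: "u \<in> crossings U pr A \<longleftrightarrow> (u \<bullet> v) * (u \<bullet> y) < 0" if u: "u \<in> U" and y: "y \<in> region U A" for u y
  proof -
    have "(u \<bullet> v) * (u \<bullet> y) < 0 \<longleftrightarrow> (u \<bullet> vpt pr) * (u \<bullet> y) < 0"
      using r mult_less_cancel_left_pos[of r "(u \<bullet> vpt pr) * (u \<bullet> y)" 0] by (simp add: mult_ac)
    then show ?thesis using crossings_opposite[OF gp pr u, of y A] y u by (simp add: region_def)
  qed
  have sub: "crossings U pr A \<subseteq> U" by (auto simp: crossings_def)
  have card_image: "card (great_circle ` crossings U pr A) = card (crossings U pr A)"
    using inj_on_subset[OF inj sub] by (rule card_image)
  have finC: "finite C" using C fin by simp
  define hits where "hits g = {c\<in>C. g ` {0<..<1} \<inter> c \<noteq> {}}" for g :: "real \<Rightarrow> real^3"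
  have lower: "great_circle ` crossings U pr A \<subseteq> hits g"
    if g: "path g" "path_image g \<subseteq> S2" "g 0 = v" "g 1 \<in> region U A" for g
  proof (rule image_subsetI)
    fix u assume u: "u \<in> crossings U pr A"
    then have uU: "u \<in> U" using sub by blast
    have opp: "(u \<bullet> g 0) * (u \<bullet> g 1) < 0" using cr[OF uU g(4)] u g(3) by simp
    have "connected (path_image g)" using g(1) by (rule connected_path_image)
    moreover have "g 0 \<in> path_image g" "g 1 \<in> path_image g" by (auto simp: path_image_def)
    ultimately have "\<exists>z\<in>path_image g. u \<bullet> z = 0"
      using opp connected_ivt_hyperplane[of "path_image g" "g 0" "g 1" u 0]
        connected_ivt_hyperplane[of "path_image g" "g 1" "g 0" u 0]
      by (auto simp: mult_less_0_iff)
    then obtain t where t: "t \<in> {0..1}" "u \<bullet> g t = 0" by (auto simp: path_image_def)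
    \<comment> \<open>The distance counts only circles met in the interior of the curve; a
      separating circle contains neither end point.\<close>
    have "t \<noteq> 0" "t \<noteq> 1" using opp t(2) by auto
    then have "t \<in> {0<..<1}" using t(1) by auto
    moreover have "g t \<in> great_circle u"
      using t g(2) by (auto simp: great_circle_def path_image_def)
    ultimately have "g t \<in> g ` {0<..<1} \<inter> great_circle u" by blast
    then show "great_circle u \<in> hits g" using uU unfolding hits_def C by blast
  qed
  have "\<exists>g. path g \<and> path_image g \<subseteq> S2 \<and> g 0 \<in> {v} \<and> g 1 \<in> region U A \<and>
      hits g \<subseteq> great_circle ` crossings U pr A"
  proof -
    obtain y where y: "y \<in> region U A" using region_nonempty[OF A ne] by blast
    have yU: "u \<bullet> y \<noteq> 0" if "u \<in> U" for u using y that by (auto simp: region_def)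
    have ny: "norm y = 1" using y by (simp add: region_def S2_def)
    have nv: "norm v = 1" using v vpt_nonzero[OF gp pr] by simp
    obtain a where a: "a \<in> U" "a \<in> ends pr" using pr by (auto simp: opairs_def ends_def)
    have av: "a \<bullet> v = 0" using ends_vpt[OF a(2)] r by simp
    define h where "h t = (1 - t) *\<^sub>R v + t *\<^sub>R y" for t
    \<comment> \<open>The segment misses 0, so it can be normalised: on a circle \<open>a\<close>
      through \<open>v\<close> the product grows linearly from 0 to \<open>a \<bullet> y\<close>,
      which is nonzero.\<close>
    have h0: "h t \<noteq> 0" for t
    proof (cases "t = 0")
      case True
      then show ?thesis using nv by (auto simp: h_def)
    next
      case False
      have "a \<bullet> h t = t * (a \<bullet> y)" using av by (simp add: h_def inner_add_right)
      then show ?thesis using False yU[OF a(1)] by auto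
    qed
    define g where "g t = (1 / norm (h t)) *\<^sub>R h t" for t
    have "path g"
      unfolding path_def g_def using h0 by (intro continuous_intros) (auto simp: h_def intro!: continuous_intros)
    moreover have "path_image g \<subseteq> S2"
      using h0 by (auto simp: path_image_def S2_def g_def)
    moreover have "g 0 \<in> {v}" "g 1 = y" using nv ny by (simp_all add: g_def h_def)
    moreover have "hits g \<subseteq> great_circle ` crossings U pr A"
    proof
      fix c assume "c \<in> hits g"
      then have "c \<in> great_circle ` U" "g ` {0<..<1} \<inter> c \<noteq> {}" by (simp_all add: hits_def C)
      then obtain u t where u: "u \<in> U" "c = great_circle u" and t: "t \<in> {0<..<1}" "g t \<in> great_circle u"
        by blast
      then have "u \<bullet> h t = 0" using h0[of t] by (simp add: g_def great_circle_def)
      \<comment> \<open>At an interior zero of a linear function the end values balance, so they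
        have opposite signs, or both vanish; the latter is excluded at \<open>y\<close>.\<close>
      then have eq: "(1 - t) * (u \<bullet> v) = - (t * (u \<bullet> y))" by (simp add: h_def inner_add_right)
      have "(1 - t) * ((u \<bullet> v) * (u \<bullet> y)) = ((1 - t) * (u \<bullet> v)) * (u \<bullet> y)" by (simp add: mult_ac)
      also have "\<dots> = - (t * (u \<bullet> y)\<^sup>2)" unfolding eq by (simp add: power2_eq_square)
      also have "\<dots> < 0" using t yU[OF u(1)] by simp
      finally have "(u \<bullet> v) * (u \<bullet> y) < 0" using t(1) by (simp add: mult_less_0_iff)
      then have "u \<in> crossings U pr A" using cr[OF u(1) y] by simp
      then show "c \<in> great_circle ` crossings U pr A" using u(2) by blast
    qed
    ultimately show ?thesis using y by blast
  qed
  then obtain g where g: "path g" "path_image g \<subseteq> S2" "g 0 \<in> {v}" "g 1 \<in> region U A"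
    "hits g \<subseteq> great_circle ` crossings U pr A" by blast
  have "hits g = great_circle ` crossings U pr A" using g lower[of g] by auto
  then have "card (crossings U pr A) = card (hits g)" using card_image by simp
  moreover have "card (crossings U pr A) \<le> card (hits g)"
    if "path g" "path_image g \<subseteq> S2" "g 0 \<in> {v}" "g 1 \<in> region U A" for g
    using card_mono[of "hits g", OF _ lower[of g]] that finC card_image by (auto simp: hits_def)
  ultimately have "Inf {card (hits g) |g. path g \<and> path_image g \<subseteq> S2 \<and> g 0 \<in> {v} \<and> g 1 \<in> region U A}
      = card (crossings U pr A)"
    using g by (intro cInf_eq_minimum) auto
  then show ?thesis by (simp add: arr_dist_def hits_def)
qed

text \<open>Every vertex is the normalised \<open>vpt\<close> of an ordered pair, the order being
  fixed by the sign of its factor along the cross product.\<close>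

lemma card_level:
  assumes gp: "general_position U" and bij: "bij_betw great_circle U C" and A: "A \<in> chambers U"
  shows "card (level C k (region U A)) \<le> card {pr\<in>opairs U. card (crossings U pr A) = k}"
proof -
  let ?f = "\<lambda>pr. (1 / norm (vpt pr)) *\<^sub>R vpt pr"
  have fin: "finite U" using gp by (rule gp_finite)
  have C: "C = great_circle ` U" using bij by (auto simp: bij_betw_def)
  have "level C k (region U A) \<subseteq> ?f ` {pr\<in>opairs U. card (crossings U pr A) = k}"
  proof
    fix v assume "v \<in> level C k (region U A)"
    then have v: "v \<in> vertices C" and dist: "arr_dist C {v} (region U A) = k"
      by (auto simp: level_def)
    obtain a b where ab: "a \<in> U" "b \<in> U" "great_circle a \<noteq> great_circle b"
      "v \<in> great_circle a" "v \<in> great_circle b"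
      using v by (auto simp: vertices_def C)
    then have "a \<noteq> b" by auto
    then have nz: "a \<times> b \<noteq> 0" using gp_pair[OF gp ab(1,2)] by simp
    have "a \<bullet> v = 0" "b \<bullet> v = 0" and nv: "norm v = 1"
      using ab by (auto simp: great_circle_def S2_def)
    then obtain m where m: "v = m *\<^sub>R (a \<times> b)" using parallel_cross nz by blast
    have "\<bar>m\<bar> * norm (a \<times> b) = 1" using nv m by simp
    then have m': "\<bar>m\<bar> = 1 / norm (a \<times> b)" using nz by (simp add: field_simps)
    have "\<exists>pr\<in>opairs U. v = ?f pr"
    proof (cases "m \<ge> 0")
      case True
      then show ?thesis using m m' ab \<open>a \<noteq> b\<close>
        by (intro bexI[of _ "(a, b)"]) (auto simp: vpt_def opairs_def)
    next
      case False
      have "v = (- m) *\<^sub>R (b \<times> a)" using m cross_skew[of a b] by simp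
      moreover have "norm (b \<times> a) = norm (a \<times> b)" using cross_skew[of a b] by simp
      moreover have "- m = 1 / norm (a \<times> b)" using False m' by simp
      ultimately have "v = ?f (b, a)" by (simp add: vpt_def)
      moreover have "(b, a) \<in> opairs U" using ab(1,2) \<open>a \<noteq> b\<close> by (simp add: opairs_def)
      ultimately show ?thesis by blast
    qed
    then obtain pr where pr: "pr \<in> opairs U" "v = ?f pr" by blast
    then have "card (crossings U pr A) = k" using arr_dist_crossings[OF gp bij pr A] dist by simp
    then show "v \<in> ?f ` {pr\<in>opairs U. card (crossings U pr A) = k}" using pr by blast
  qed
  then show ?thesis using finite_opairs[OF fin] by (intro surj_card_le) auto
qed

theorem theorem1:
  fixes C :: "(real^3) set set" and n k :: nat
  assumes "simple_arrangement C"
    and "card C = n"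
    and "real k < real n / 3"
  shows "(\<Sum>F\<in>cells C. real (card (level C k F))) / real (card (cells C))
           \<le> 4 * exp 1 * (real k + 2)^2"
proof -
  obtain U where gp: "general_position U" and bij: "bij_betw great_circle U C"
    using simple_arrangement_normals[OF assms(1)] by blast
  have fin: "finite U" using gp by (rule gp_finite)
  have "card U = n" using bij_betw_same_card[OF bij] assms(2) by simp
  then have k: "3 * k < card U" using assms(3) by linarith
  then have ne: "U \<noteq> {}" by auto
  have cells: "cells C = region U ` chambers U" and inj: "inj_on (region U) (chambers U)"
    using cells_regions[OF bij ne] by auto
  have "(\<Sum>F\<in>cells C. card (level C k F)) = (\<Sum>A\<in>chambers U. card (level C k (region U A)))"
    unfolding cells by (simp add: sum.reindex[OF inj])
  also have "\<dots> \<le> (\<Sum>A\<in>chambers U. card {pr\<in>opairs U. card (crossings U pr A) = k})"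
    by (intro sum_mono card_level[OF gp bij])
  also have "\<dots> = card (Sigma (chambers U) (\<lambda>A. {pr\<in>opairs U. card (crossings U pr A) = k}))"
    using finite_chambers[OF fin] finite_opairs[OF fin] by (simp add: card_SigmaI)
  \<comment> \<open>The sum of level sizes over all cells is read as a count of pairs of a vertex
    and a cell.\<close>
  also have "\<dots> = card (level_pairs U k)"
    by (rule bij_betw_same_card[of prod.swap], rule bij_betwI[of _ _ _ prod.swap])
      (auto simp: level_pairs_def)
  finally have "real (\<Sum>F\<in>cells C. card (level C k F)) \<le> 4 * exp 1 * (real k + 2)\<^sup>2 * card (chambers U)"
    using level_pairs_average[OF gp k] by linarith
  moreover have "card (cells C) = card (chambers U)" unfolding cells by (rule card_image[OF inj])
  moreover have "card (chambers U) > 0"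
  proof -
    obtain u where "u \<in> U" using ne by blast
    then have "u \<noteq> 0" using gp_zero[OF gp] by auto
    then have "positive U u \<union> {} \<in> chambers U" by (rule free_signs[OF gp]) simp
    then show ?thesis using finite_chambers[OF fin] by (auto simp: card_gt_0_iff)
  qed
  ultimately show ?thesis by (simp add: divide_le_eq)
qed

end
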